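(* Let $n\geq 1$, $p>2$, let $(\Omega_1,\Omega_2)$ be a good pair of domains in $\mathbb{C}$ and let $J\in\mathcal{J}$, i.e. $J$ is a smooth almost complex structure on $\mathbb{R}^{2n}$ with $\det(J+J_{st})\neq 0$ on $\mathbb{R}^{2n}$. Let $\mathcal{W}_1\subset \mathcal{O}_J(\Omega_1)$ and $\mathcal{W}_2\subset \mathcal{O}_J(\Omega_2)$ be two families of $J$-holomorphic maps that are precompact in the spaces $W^{1,p}(\Omega_1)$ and $W^{1,p}(\Omega_2)$, respectively. Then for every $\epsilon>0$ there is $\delta>0$ such that for every $f_1\in \mathcal{W}_1$ and $f_2\in \mathcal{W}_2$ satisfying $\|f_1-f_2\|_{W^{1,p}(\Omega_1\cap\Omega_2)}<\delta$ there exists a map $\widehat{f}\in \mathcal{O}_J(\Omega_1\cup\Omega_2)$ such that $$\|\widehat{f}-f_1\|_{W^{1,p}(\Omega_1)}<\epsilon\quad\text{and}\quad\|\widehat{f}-f_2\|_{W^{1,p}(\Omega_2)}<\epsilon.$$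
   Context: Good pair: let $\Omega_1,\Omega_2\subset\mathbb{C}$ be bounded simply connected domains with $\mathcal{C}^1$-boundary. The pair $(\Omega_1,\Omega_2)$ is called a good pair if $\Omega_1\cap\Omega_2$ is simply connected with $\mathcal{C}^1$-boundary and $\overline{\Omega_1\setminus\Omega_2}\cap\overline{\Omega_2\setminus\Omega_1}=\emptyset$. Almost complex structures: $J$ denotes a smooth $2n\times 2n$ real matrix function defined on $\mathbb{R}^{2n}$ with $J^2=-\mathrm{id}$. $J_{st}$ is the standard structure, i.e. multiplication by the imaginary unit under $\mathbb{R}^{2n}\cong\mathbb{C}^n$ (and also on $\mathbb{R}^2\cong\mathbb{C}$). $\mathcal{J}$ is the set of such $J$ with $\det(J+J_{st})\neq0$ everywhere on $\mathbb{R}^{2n}$. $J$-holomorphic maps: for a bounded domain $\Omega\subset\mathbb{C}$ and fixed $p>2$, $W^{1,p}(\Omega)$ denotes the Sobolev space of maps $\Omega\to\mathbb{R}^{2n}$. A map $f\in W^{1,p}(\Omega)$ is $J$-holomorphic if $df\circ J_{st}=J(f)\circ df$ (a.e. on $\Omega$). $\mathcal{O}_J(\Omega)\subset W^{1,p}(\Omega)$ is the set of $J$-holomorphic maps. Precompact means having compact closure. *)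

theory Defs
  imports "HOL-Analysis.Analysis"
begin

section \<open>Good pairs of planar domains\<close>

text \<open>Near each boundary point, after a rotation, the set is the strict epigraph of a
  \<open>C\<^sup>1\<close> function of one real variable.\<close>

definition C1_boundary :: "complex set \<Rightarrow> bool" where
  "C1_boundary \<Omega> \<longleftrightarrow>
     (\<forall>z\<in>frontier \<Omega>. \<exists>r>0. \<exists>u::complex. \<exists>\<gamma>::real \<Rightarrow> real.
        norm u = 1 \<and> \<gamma> C1_differentiable_on UNIV \<and>
        \<Omega> \<inter> ball z r = {w \<in> ball z r. Im (u * w) > \<gamma> (Re (u * w))})"

definition good_pair :: "complex set \<Rightarrow> complex set \<Rightarrow> bool" where
  "good_pair \<Omega>\<^sub>1 \<Omega>\<^sub>2 \<longleftrightarrow>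
     (\<forall>\<Omega>\<in>{\<Omega>\<^sub>1, \<Omega>\<^sub>2}. open \<Omega> \<and> \<Omega> \<noteq> {} \<and> bounded \<Omega> \<and> simply_connected \<Omega> \<and> C1_boundary \<Omega>) \<and>
     simply_connected (\<Omega>\<^sub>1 \<inter> \<Omega>\<^sub>2) \<and> C1_boundary (\<Omega>\<^sub>1 \<inter> \<Omega>\<^sub>2) \<and>
     closure (\<Omega>\<^sub>1 - \<Omega>\<^sub>2) \<inter> closure (\<Omega>\<^sub>2 - \<Omega>\<^sub>1) = {}"


section \<open>Smooth maps\<close>

primrec Ck :: "nat \<Rightarrow> ('a::euclidean_space \<Rightarrow> 'b::real_normed_vector) \<Rightarrow> bool" where
  "Ck 0 f \<longleftrightarrow> continuous_on UNIV f"
| "Ck (Suc k) f \<longleftrightarrow>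
     (\<forall>x. f differentiable at x) \<and> (\<forall>v. Ck k (\<lambda>x. frechet_derivative f (at x) v))"

definition smooth :: "('a::euclidean_space \<Rightarrow> 'b::real_normed_vector) \<Rightarrow> bool" where
  "smooth f \<longleftrightarrow> (\<forall>k. Ck k f)"

definition test_functions :: "complex set \<Rightarrow> (complex \<Rightarrow> real) set" where
  "test_functions \<Omega> =
     {\<phi>. smooth \<phi> \<and> compact (closure {z. \<phi> z \<noteq> 0}) \<and> closure {z. \<phi> z \<noteq> 0} \<subseteq> \<Omega>}"


section \<open>The Sobolev spaces of order one\<close>

text \<open>Elements of Sobolev spaces are represented by functions on the whole plane, of which only
  the restriction to \<open>\<Omega>\<close>, up to null sets, matters; so the norm below is a seminorm on
  representatives, and the topology is the one it induces.\<close>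

definition Lp :: "real \<Rightarrow> complex set \<Rightarrow> (complex \<Rightarrow> 'a::euclidean_space) set" where
  "Lp p \<Omega> = {f \<in> borel_measurable (lebesgue_on \<Omega>).
     integrable (lebesgue_on \<Omega>) (\<lambda>z. norm (f z) powr p)}"

definition locally_integrable :: "complex set \<Rightarrow> (complex \<Rightarrow> 'a::euclidean_space) \<Rightarrow> bool" where
  "locally_integrable \<Omega> f \<longleftrightarrow> (\<forall>K. compact K \<and> K \<subseteq> \<Omega> \<longrightarrow> integrable (lebesgue_on K) f)"

definition has_weak_deriv ::
  "complex set \<Rightarrow> (complex \<Rightarrow> 'a::euclidean_space) \<Rightarrow> complex \<Rightarrow> (complex \<Rightarrow> 'a) \<Rightarrow> bool" where
  "has_weak_deriv \<Omega> f v g \<longleftrightarrow> locally_integrable \<Omega> f \<and> locally_integrable \<Omega> g \<and>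
     (\<forall>\<phi>\<in>test_functions \<Omega>.
        (LINT z|lebesgue_on \<Omega>. frechet_derivative \<phi> (at z) v *\<^sub>R f z)
          = - (LINT z|lebesgue_on \<Omega>. \<phi> z *\<^sub>R g z))"

definition weak_deriv ::
  "complex set \<Rightarrow> (complex \<Rightarrow> 'a::euclidean_space) \<Rightarrow> complex \<Rightarrow> complex \<Rightarrow> 'a" where
  "weak_deriv \<Omega> f v = (SOME g. has_weak_deriv \<Omega> f v g)"

definition sobolev :: "real \<Rightarrow> complex set \<Rightarrow> (complex \<Rightarrow> 'a::euclidean_space) set" where
  "sobolev p \<Omega> = {f \<in> Lp p \<Omega>. \<forall>v\<in>{1, \<i>}. \<exists>g\<in>Lp p \<Omega>. has_weak_deriv \<Omega> f v g}"

definition sobolev_norm :: "real \<Rightarrow> complex set \<Rightarrow> (complex \<Rightarrow> 'a::euclidean_space) \<Rightarrow> real" where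
  "sobolev_norm p \<Omega> f =
     ((LINT z|lebesgue_on \<Omega>. norm (f z) powr p)
      + (LINT z|lebesgue_on \<Omega>. norm (weak_deriv \<Omega> f 1 z) powr p)
      + (LINT z|lebesgue_on \<Omega>. norm (weak_deriv \<Omega> f \<i> z) powr p)) powr (1 / p)"

definition sobolev_topology ::
  "real \<Rightarrow> complex set \<Rightarrow> (complex \<Rightarrow> 'a::euclidean_space) topology" where
  "sobolev_topology p \<Omega> = topology (\<lambda>U. U \<subseteq> sobolev p \<Omega> \<and>
     (\<forall>f\<in>U. \<exists>e>0. \<forall>g\<in>sobolev p \<Omega>. sobolev_norm p \<Omega> (\<lambda>z. g z - f z) < e \<longrightarrow> g \<in> U))"

lemma openin_sobolev_topology:
  fixes U :: "(complex \<Rightarrow> 'a::euclidean_space) set"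
  shows "openin (sobolev_topology p \<Omega>) U \<longleftrightarrow> U \<subseteq> sobolev p \<Omega> \<and>
     (\<forall>f\<in>U. \<exists>e>0. \<forall>g\<in>sobolev p \<Omega>. sobolev_norm p \<Omega> (\<lambda>z. g z - f z) < e \<longrightarrow> g \<in> U)"
proof -
  let ?L = "\<lambda>U :: (complex \<Rightarrow> 'a) set. U \<subseteq> sobolev p \<Omega> \<and>
     (\<forall>f\<in>U. \<exists>e>0. \<forall>g\<in>sobolev p \<Omega>. sobolev_norm p \<Omega> (\<lambda>z. g z - f z) < e \<longrightarrow> g \<in> U)"
  have "?L (S \<inter> T)" if S: "?L S" and T: "?L T" for S T
  proof (intro conjI ballI)
    show "S \<inter> T \<subseteq> sobolev p \<Omega>" using S by blast
    fix f assume f: "f \<in> S \<inter> T"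
    obtain d where d: "d > 0"
        "\<forall>g\<in>sobolev p \<Omega>. sobolev_norm p \<Omega> (\<lambda>z. g z - f z) < d \<longrightarrow> g \<in> S"
      using S f by blast
    obtain e where e: "e > 0"
        "\<forall>g\<in>sobolev p \<Omega>. sobolev_norm p \<Omega> (\<lambda>z. g z - f z) < e \<longrightarrow> g \<in> T"
      using T f by blast
    show "\<exists>e>0. \<forall>g\<in>sobolev p \<Omega>. sobolev_norm p \<Omega> (\<lambda>z. g z - f z) < e \<longrightarrow> g \<in> S \<inter> T"
      using d e by (intro exI[of _ "min d e"]) auto
  qed
  moreover have "?L (\<Union>\<K>)" if "\<forall>K\<in>\<K>. ?L K" for \<K>
    using that by (meson Sup_least UnionE UnionI)
  ultimately have "istopology ?L"
    unfolding istopology_def by blast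
  then show ?thesis
    unfolding sobolev_topology_def by (simp only: topology_inverse')
qed

lemma topspace_sobolev_topology: "topspace (sobolev_topology p \<Omega>) = sobolev p \<Omega>"
proof -
  have "openin (sobolev_topology p \<Omega>) (sobolev p \<Omega>)"
    unfolding openin_sobolev_topology by (auto intro: zero_less_one)
  then show ?thesis
    by (meson openin_sobolev_topology openin_subset openin_topspace subset_antisym)
qed

definition precompact_in :: "'a topology \<Rightarrow> 'a set \<Rightarrow> bool" where
  "precompact_in X S \<longleftrightarrow> S \<subseteq> topspace X \<and> compactin X (X closure_of S)"


section \<open>Almost complex structures and J-holomorphic maps\<close>

text \<open>\<open>\<real>\<^sup>2\<^sup>n\<close> is \<open>real ^ ('n + 'n)\<close>, identified with \<open>\<complex>\<^sup>n\<close> by \<open>z\<^sub>k = x\<^sub>k + \<i> y\<^sub>k\<close>, where \<open>x\<^sub>k\<close> and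
  \<open>y\<^sub>k\<close> are the components with index \<open>Inl k\<close> and \<open>Inr k\<close>.\<close>

definition J_st :: "real ^ ('n::finite + 'n) ^ ('n + 'n)" where
  "J_st = matrix (\<lambda>x. \<chi> k. case k of Inl i \<Rightarrow> - (x $ Inr i) | Inr i \<Rightarrow> x $ Inl i)"

definition almost_complex_structures ::
  "(real ^ ('n::finite + 'n) \<Rightarrow> real ^ ('n + 'n) ^ ('n + 'n)) set" where
  "almost_complex_structures =
     {J. smooth J \<and> (\<forall>x. J x ** J x = - mat 1) \<and> (\<forall>x. det (J x + J_st) \<noteq> 0)}"

definition weak_differential ::
  "complex set \<Rightarrow> (complex \<Rightarrow> 'a::euclidean_space) \<Rightarrow> complex \<Rightarrow> complex \<Rightarrow> 'a" where
  "weak_differential \<Omega> f z h = Re h *\<^sub>R weak_deriv \<Omega> f 1 z + Im h *\<^sub>R weak_deriv \<Omega> f \<i> z"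

definition J_holomorphic ::
  "(real ^ ('n::finite + 'n) \<Rightarrow> real ^ ('n + 'n) ^ ('n + 'n)) \<Rightarrow> real \<Rightarrow> complex set
     \<Rightarrow> (complex \<Rightarrow> real ^ ('n + 'n)) set" where
  "J_holomorphic J p \<Omega> = {f \<in> sobolev p \<Omega>.
     AE z in lebesgue_on \<Omega>. \<forall>h.
       weak_differential \<Omega> f z (\<i> * h) = J (f z) *v weak_differential \<Omega> f z h}"

end

theory Submission
  imports Defs
begin

text \<open>The precompactness hypotheses already yield the gluing, without solving the Cauchy--Riemann
  equation. On the compact product of the closures of the two families, consider a pair \<open>(g\<^sub>1, g\<^sub>2)\<close>;
  both members are again J-holomorphic, since \<open>L\<^sup>p\<close> convergence of a sequence and of its first
  derivatives implies almost everywhere convergence along a subsequence. If \<open>g\<^sub>1\<close> and \<open>g\<^sub>2\<close> agree on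
  the overlap, they glue to a J-holomorphic map on the union, which serves for all
  \<open>(f\<^sub>1, f\<^sub>2)\<close> near \<open>(g\<^sub>1, g\<^sub>2)\<close>; if they do not, all nearby pairs stay a definite distance apart on the
  overlap. A finite subcover gives a uniform \<open>\<delta>\<close>.\<close>

section \<open>Smooth cut-off functions\<close>

text \<open>Maps are only representatives and \<open>weak_deriv\<close> is an arbitrary choice, so
  every identity between weak derivatives holds merely almost everywhere. The analytic input is
  therefore twofold: uniqueness of weak derivatives, that is the fundamental lemma of the calculus
  of variations, and their locality, by which weak derivatives on two open sets combine to one on
  the union. Both rest on smooth cut-off functions, which are built here from
  \<open>exp (- inverse t)\<close>. Since \<open>\<delta>\<close> is obtained by compactness, it
  depends on the families themselves and not just on \<open>\<epsilon>\<close>, \<open>J\<close> and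
  the domains; no explicit value comes out.\<close>

lemma Ck_SucI:
  assumes "\<And>x. (f has_derivative D x) (at x)" and "\<And>v. Ck k (\<lambda>x. D x v)"
  shows "Ck (Suc k) f"
proof -
  \<comment> \<open>Uniqueness of the derivative allows any explicit formula \<open>D\<close> to be
    used in place of \<open>frechet_derivative\<close>.\<close>
  have "frechet_derivative f (at x) = D x" for x
    using assms(1) frechet_derivative_at by metis
  then show ?thesis
    using assms by (auto simp: differentiable_def)
qed

lemma Ck_Suc_has_derivative:
  "Ck (Suc k) f \<Longrightarrow> (f has_derivative frechet_derivative f (at x)) (at x)"
  by (simp add: frechet_derivative_works)

text \<open>The recursion for \<open>Ck\<close> never mentions the lower orders of \<open>f\<close>
  itself, so they are recovered by induction; at the bottom, differentiability gives
  continuity.\<close>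

lemma Ck_SucD: "Ck (Suc k) f \<Longrightarrow> Ck k f"
proof (induction k arbitrary: f)
  case 0
  then show ?case
    by (auto intro!: continuous_at_imp_continuous_on differentiable_imp_continuous_within)
next
  case (Suc k)
  then show ?case
    by (metis Ck.simps(2))
qed

section \<open>Smoothness of constants, linear maps and algebraic combinations\<close>

lemma Ck_const: "Ck k (\<lambda>x. c)"
proof (induction k arbitrary: c)
  case (Suc k)
  show ?case
    by (rule Ck_SucI[OF has_derivative_const Suc])
qed simp

lemma Ck_bounded_linear: "bounded_linear f \<Longrightarrow> Ck k f"
proof (cases k)
  case 0
  assume "bounded_linear f"
  with 0 show ?thesis by (simp add: linear_continuous_on)
next
  case (Suc m)
  assume "bounded_linear f"
  then have "Ck (Suc m) f"
    by (intro Ck_SucI[where D = "\<lambda>_. f"] bounded_linear_imp_has_derivative Ck_const)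
  with Suc show ?thesis by simp
qed

lemma Ck_add: "Ck k f \<Longrightarrow> Ck k g \<Longrightarrow> Ck k (\<lambda>x. f x + g x)"
proof (induction k arbitrary: f g)
  case 0
  then show ?case by (auto intro: continuous_on_add)
next
  case (Suc k)
  show ?case
  proof (rule Ck_SucI)
    show "((\<lambda>x. f x + g x) has_derivative
      (\<lambda>v. frechet_derivative f (at x) v + frechet_derivative g (at x) v)) (at x)" for x
      using Suc.prems by (intro has_derivative_add Ck_Suc_has_derivative)
  qed (use Suc in auto)
qed

lemma Ck_mult:
  fixes f g :: "'a::euclidean_space \<Rightarrow> real"
  shows "Ck k f \<Longrightarrow> Ck k g \<Longrightarrow> Ck k (\<lambda>x. f x * g x)"
proof (induction k arbitrary: f g)
  case 0
  then show ?case by (auto intro: continuous_on_mult)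
next
  case (Suc k)
  show ?case
  proof (rule Ck_SucI)
    show "((\<lambda>x. f x * g x) has_derivative
      (\<lambda>v. f x * frechet_derivative g (at x) v + frechet_derivative f (at x) v * g x)) (at x)" for x
      using Suc.prems by (intro has_derivative_mult Ck_Suc_has_derivative)
    show "Ck k (\<lambda>x. f x * frechet_derivative g (at x) v + frechet_derivative f (at x) v * g x)" for v
      \<comment> \<open>The product rule leaves \<open>f\<close> and \<open>g\<close>
        undifferentiated; \<open>Ck_SucD\<close> lowers them to the order of the induction
        hypothesis.\<close>
      using Suc.prems by (intro Ck_add Suc.IH) (auto intro: Ck_SucD)
  qed
qed

lemma Ck_diff:
  fixes f g :: "'a::euclidean_space \<Rightarrow> real"
  assumes "Ck k f" "Ck k g"
  shows "Ck k (\<lambda>x. f x - g x)"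
  using Ck_add[OF assms(1) Ck_mult[OF Ck_const[of k "-1"] assms(2)]] by simp

text \<open>The derivative contains the inverse of the same \<open>f\<close> again, but only at
  order \<open>k\<close>, so the induction closes with \<open>f\<close> fixed.\<close>

lemma Ck_inverse:
  fixes f :: "'a::euclidean_space \<Rightarrow> real"
  assumes "\<And>x. f x \<noteq> 0"
  shows "Ck k f \<Longrightarrow> Ck k (\<lambda>x. inverse (f x))"
proof (induction k)
  case 0
  then show ?case using assms by (auto intro: continuous_on_inverse)
next
  case (Suc k)
  show ?case
  proof (rule Ck_SucI)
    show "((\<lambda>x. inverse (f x)) has_derivative
      (\<lambda>v. - (inverse (f x) * frechet_derivative f (at x) v * inverse (f x)))) (at x)" for x
      by (rule Deriv.has_derivative_inverse[OF assms Ck_Suc_has_derivative[OF Suc.prems]])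
    have "Ck k (\<lambda>x. inverse (f x))"
      using Suc by (metis Ck_SucD)
    moreover have "Ck k (\<lambda>x. frechet_derivative f (at x) v)" for v
      using Suc.prems by simp
    ultimately have "Ck k (\<lambda>x. 0 - (inverse (f x) * frechet_derivative f (at x) v * inverse (f x)))" for v
      by (intro Ck_diff Ck_mult Ck_const)
    then show "Ck k (\<lambda>x. - (inverse (f x) * frechet_derivative f (at x) v * inverse (f x)))" for v
      by simp
  qed
qed

lemma Ck_prod:
  fixes f :: "'i \<Rightarrow> 'a::euclidean_space \<Rightarrow> real"
  shows "finite I \<Longrightarrow> (\<And>i. i \<in> I \<Longrightarrow> Ck k (f i)) \<Longrightarrow> Ck k (\<lambda>x. \<Prod>i\<in>I. f i x)"
proof (induction I rule: finite_induct)
  case (insert i I)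
  then have "Ck k (\<lambda>x. f i x * (\<Prod>i\<in>I. f i x))"
    by (intro Ck_mult) auto
  with insert show ?case by simp
qed (simp add: Ck_const)

lemma smooth_mult:
  fixes f g :: "'a::euclidean_space \<Rightarrow> real"
  shows "smooth f \<Longrightarrow> smooth g \<Longrightarrow> smooth (\<lambda>x. f x * g x)"
  by (simp add: smooth_def Ck_mult)

lemma smooth_diff:
  fixes f g :: "'a::euclidean_space \<Rightarrow> real"
  shows "smooth f \<Longrightarrow> smooth g \<Longrightarrow> smooth (\<lambda>x. f x - g x)"
  by (simp add: smooth_def Ck_diff)

lemma smooth_const: "smooth (\<lambda>x. c)"
  by (simp add: smooth_def Ck_const)

text \<open>Squaring removes the singularity of the norm at \<open>a\<close>. The derivative in a
  fixed direction is affine in \<open>x\<close>, so all orders follow without induction.\<close>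

lemma Ck_norm_square:
  fixes a :: "'a::euclidean_space"
  shows "Ck k (\<lambda>x. (norm (x - a))\<^sup>2)"
proof (cases k)
  case 0
  then show ?thesis by (auto intro!: continuous_intros)
next
  case (Suc m)
  have "Ck (Suc m) (\<lambda>x. (x - a) \<bullet> (x - a))"
  proof (rule Ck_SucI)
    show "((\<lambda>x. (x - a) \<bullet> (x - a)) has_derivative (\<lambda>v. 2 * (x \<bullet> v) - 2 * (a \<bullet> v))) (at x)" for x
      by (auto intro!: derivative_eq_intros simp: algebra_simps inner_commute)
    show "Ck m (\<lambda>x. 2 * (x \<bullet> v) - 2 * (a \<bullet> v))" for v
      by (intro Ck_diff Ck_const Ck_bounded_linear bounded_linear_intros)
  qed
  with Suc show ?thesis by (simp add: power2_norm_eq_inner)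
qed

text \<open>The family \<open>t\<^sup>-\<^sup>n e\<^sup>-\<^sup>1\<^sup>/\<^sup>t\<close>, extended by zero, is closed under differentiation up to
  linear combinations, which gives smoothness of all its members by one induction.\<close>

definition flat :: "nat \<Rightarrow> real \<Rightarrow> real" where
  "flat n t = (if t > 0 then inverse t ^ n * exp (- inverse t) else 0)"

text \<open>With s = 1/t the right-hand limit is that of s^n / e^s at infinity; on the left the
  function vanishes.\<close>

lemma flat_tendsto_0: "(flat n \<longlongrightarrow> 0) (at 0)"
proof (rule filterlim_split_at)
  show "(flat n \<longlongrightarrow> 0) (at_left 0)"
    by (rule tendsto_eventually) (auto simp: eventually_at_filter flat_def)
  have "((\<lambda>t. inverse t ^ n / exp (inverse t)) \<longlongrightarrow> (0::real)) (at_right 0)"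
    by (rule filterlim_compose[OF tendsto_power_div_exp_0 filterlim_inverse_at_top_right])
  then show "(flat n \<longlongrightarrow> 0) (at_right 0)"
    by (rule Lim_transform_eventually)
      (auto simp: eventually_at_filter flat_def exp_minus divide_inverse)
qed

text \<open>Differentiating the exponential raises the exponent by two, differentiating the power
  raises it by one, so the derivative stays in the span of the family. At 0 the difference quotient
  of \<open>flat n\<close> is \<open>flat (n + 1)\<close>, which tends to 0.\<close>

lemma DERIV_flat:
  "(flat n has_real_derivative flat (n + 2) t - real n * flat (n + 1) t) (at t)"
proof (cases t "0::real" rule: linorder_cases)
  case less
  have "((\<lambda>_. 0) has_real_derivative 0) (at t)" by simp
  then have "(flat n has_real_derivative 0) (at t)"
    by (rule has_field_derivative_transform_within_open[of _ _ _ "{..<0}"])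
      (use less in \<open>auto simp: flat_def\<close>)
  with less show ?thesis by (simp add: flat_def)
next
  case equal
  have "((\<lambda>h. flat (n + 1) h) \<longlongrightarrow> 0) (at 0)" by (rule flat_tendsto_0)
  then have "((\<lambda>h. (flat n h - flat n 0) / (h - 0)) \<longlongrightarrow> 0) (at 0)"
    by (rule Lim_transform_eventually)
      (auto simp: eventually_at_filter flat_def divide_inverse)
  with equal show ?thesis
    by (simp add: has_field_derivative_iff flat_def)
next
  case greater
  have "((\<lambda>t. inverse t ^ n * exp (- inverse t)) has_real_derivative
      flat (n + 2) t - real n * flat (n + 1) t) (at t)"
  proof -
    have "((\<lambda>t. inverse t ^ n * exp (- inverse t)) has_real_derivative
        inverse t ^ n * (exp (- inverse t) * (inverse t)\<^sup>2)
          - real n * (inverse t)\<^sup>2 * inverse t ^ (n - 1) * exp (- inverse t)) (at t)"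
      using greater by (auto intro!: derivative_eq_intros simp: power2_eq_square)
    \<comment> \<open>For \<open>n = 0\<close> the truncated exponent \<open>n - 1\<close> does no
      harm, because the factor \<open>real n\<close> makes both sides zero.\<close>
    moreover have "real n * (inverse t)\<^sup>2 * inverse t ^ (n - 1) = real n * inverse t ^ (n + 1)"
      by (cases n) (auto simp: power2_eq_square)
    moreover have "flat (n + 2) t = inverse t ^ n * (exp (- inverse t) * (inverse t)\<^sup>2)"
      using greater by (simp add: flat_def power2_eq_square)
    moreover have "flat (n + 1) t = inverse t ^ (n + 1) * exp (- inverse t)"
      using greater by (simp add: flat_def)
    ultimately show ?thesis
      by (simp only: mult.assoc[symmetric])
  qed
  then show ?thesis
    by (rule has_field_derivative_transform_within_open[of _ _ _ "{0<..}"])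
      (use greater in \<open>auto simp: flat_def\<close>)
qed

lemma Ck_flat:
  fixes q :: "'a::euclidean_space \<Rightarrow> real"
  shows "Ck k q \<Longrightarrow> Ck k (\<lambda>x. flat n (q x))"
\<comment> \<open>The index must vary, since the derivative of \<open>flat n\<close> refers to
  \<open>n + 1\<close> and \<open>n + 2\<close>.\<close>
proof (induction k arbitrary: n)
  case 0
  have "continuous_on UNIV (flat n)"
    using DERIV_flat DERIV_isCont continuous_at_imp_continuous_on by blast
  with 0 show ?case
    by (auto intro: continuous_on_compose2)
next
  case (Suc k)
  show ?case
  proof (rule Ck_SucI)
    show "((\<lambda>x. flat n (q x)) has_derivative
      (\<lambda>v. frechet_derivative q (at x) v * (flat (n + 2) (q x) - real n * flat (n + 1) (q x)))) (at x)" for x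
      using DERIV_compose_FDERIV[OF DERIV_flat Ck_Suc_has_derivative[OF Suc.prems]] .
    have "Ck k (\<lambda>x. frechet_derivative q (at x) v)" for v
      using Suc.prems by simp
    moreover have "Ck k q"
      using Suc.prems by (rule Ck_SucD)
    ultimately show "Ck k (\<lambda>x. frechet_derivative q (at x) v *
        (flat (n + 2) (q x) - real n * flat (n + 1) (q x)))" for v
      by (intro Ck_mult Ck_diff Ck_const Suc.IH)
  qed
qed

section \<open>Bump functions and cut-offs around compact sets\<close>

text \<open>The classical quotient \<open>A / (A + B)\<close>: \<open>A\<close> is positive exactly
  inside radius \<open>2 * r\<close> and \<open>B\<close> exactly outside radius \<open>r\<close>.
  The two regions cover the space, so the denominator never vanishes.\<close>

lemma smooth_bump:
  fixes a :: "'a::euclidean_space"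
  assumes "r > 0"
  obtains b :: "'a \<Rightarrow> real" where "smooth b" "\<And>x. 0 \<le> b x" "\<And>x. b x \<le> 1"
    "\<And>x. x \<in> ball a r \<Longrightarrow> b x = 1" "\<And>x. x \<notin> cball a (2 * r) \<Longrightarrow> b x = 0"
proof -
  define A where "A = (\<lambda>x. flat 0 ((2 * r)\<^sup>2 - (norm (x - a))\<^sup>2))"
  define B where "B = (\<lambda>x. flat 0 ((norm (x - a))\<^sup>2 - r\<^sup>2))"
  define b where "b = (\<lambda>x. A x * inverse (A x + B x))"
  have nonneg: "A x \<ge> 0" "B x \<ge> 0" for x
    by (auto simp: A_def B_def flat_def)
  have "r\<^sup>2 < (2 * r)\<^sup>2" using assms by (simp add: power2_eq_square)
  then have cover: "0 < (2 * r)\<^sup>2 - (norm (x - a))\<^sup>2 \<or> 0 < (norm (x - a))\<^sup>2 - r\<^sup>2" for x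
    by linarith
  have "A x > 0 \<or> B x > 0" for x
    using cover[of x] by (auto simp add: A_def B_def flat_def)
  then have pos: "A x + B x > 0" for x
    using nonneg[of x] by (meson add_nonneg_pos add_pos_nonneg)
  show thesis
  proof
    have "Ck k A" "Ck k B" for k
      unfolding A_def B_def by (intro Ck_flat Ck_diff Ck_const Ck_norm_square)+
    moreover have "A x + B x \<noteq> 0" for x
      using pos[of x] by simp
    ultimately have "Ck k b" for k
      unfolding b_def by (intro Ck_mult Ck_inverse Ck_add)
    then show "smooth b" by (simp add: smooth_def)
    show "0 \<le> b x" for x
      using nonneg pos[of x] by (auto simp: b_def)
    show "b x \<le> 1" for x
      using nonneg(2)[of x] pos[of x] by (auto simp: b_def divide_inverse[symmetric])
    show "b x = 1" if "x \<in> ball a r" for x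
    proof -
      have "(norm (x - a))\<^sup>2 \<le> r\<^sup>2"
        using that by (intro power_mono) (auto simp: dist_norm norm_minus_commute)
      then have "B x = 0" by (simp add: B_def flat_def)
      with pos[of x] show ?thesis by (simp add: b_def)
    qed
    show "b x = 0" if "x \<notin> cball a (2 * r)" for x
    proof -
      have "(2 * r)\<^sup>2 \<le> (norm (x - a))\<^sup>2"
        using that assms by (intro power_mono) (auto simp: dist_norm norm_minus_commute)
      then show ?thesis by (simp add: b_def A_def flat_def)
    qed
  qed
qed

text \<open>The value 1 is taken on an open \<open>V\<close> around \<open>K\<close>, not just on
  \<open>K\<close>. Then \<open>1 - \<psi>\<close> vanishes near \<open>K\<close>, which makes it
  possible to split a test function between two open sets.\<close>

lemma smooth_cutoff:
  fixes K U :: "'a::euclidean_space set"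
  assumes "compact K" "open U" "K \<subseteq> U"
  obtains \<psi> :: "'a \<Rightarrow> real" and V where "smooth \<psi>" "\<And>x. 0 \<le> \<psi> x" "\<And>x. \<psi> x \<le> 1"
    "open V" "K \<subseteq> V" "\<And>x. x \<in> V \<Longrightarrow> \<psi> x = 1"
    "compact (closure {x. \<psi> x \<noteq> 0})" "closure {x. \<psi> x \<noteq> 0} \<subseteq> U"
proof -
  have "\<exists>r>0. cball x (2 * r) \<subseteq> U" if "x \<in> K" for x
  proof -
    have "x \<in> U" using that assms(3) by blast
    with assms(2) obtain e where "e > 0" "cball x e \<subseteq> U"
      using open_contains_cball_eq by blast
    then show ?thesis by (intro exI[of _ "e / 2"]) simp
  qed
  then obtain r where r: "\<And>x. x \<in> K \<Longrightarrow> r x > 0" "\<And>x. x \<in> K \<Longrightarrow> cball x (2 * r x) \<subseteq> U"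
    by metis
  obtain C where C: "C \<subseteq> K" "finite C" "K \<subseteq> (\<Union>x\<in>C. ball x (r x))"
    by (rule compactE_image[OF assms(1), of K "\<lambda>x. ball x (r x)"]) (use r in auto)
  have "\<forall>c\<in>C. \<exists>b. smooth b \<and> (\<forall>x. 0 \<le> b x \<and> b x \<le> 1) \<and> (\<forall>x\<in>ball c (r c). b x = 1) \<and>
      (\<forall>x. x \<notin> cball c (2 * r c) \<longrightarrow> b x = (0::real))"
  proof
    fix c assume "c \<in> C"
    then have "r c > 0" using r(1) C(1) by blast
    obtain b where "smooth b" "\<And>x. 0 \<le> b x" "\<And>x. b x \<le> 1"
      "\<And>x. x \<in> ball c (r c) \<Longrightarrow> b x = 1" "\<And>x. x \<notin> cball c (2 * r c) \<Longrightarrow> b x = (0::real)"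
      by (rule smooth_bump[OF \<open>r c > 0\<close>, of c]) (rule that)
    then show "\<exists>b. smooth b \<and> (\<forall>x. 0 \<le> b x \<and> b x \<le> 1) \<and> (\<forall>x\<in>ball c (r c). b x = 1) \<and>
      (\<forall>x. x \<notin> cball c (2 * r c) \<longrightarrow> b x = (0::real))"
      by (intro exI[of _ b] conjI allI ballI impI)
  qed
  from bchoice[OF this] obtain b where "\<forall>c\<in>C. smooth (b c) \<and> (\<forall>x. 0 \<le> b c x \<and> b c x \<le> 1) \<and>
      (\<forall>x\<in>ball c (r c). b c x = 1) \<and> (\<forall>x. x \<notin> cball c (2 * r c) \<longrightarrow> b c x = (0::real))"
    ..
  then have b: "\<And>c. c \<in> C \<Longrightarrow> smooth (b c)" "\<And>c x. c \<in> C \<Longrightarrow> 0 \<le> b c x"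
    "\<And>c x. c \<in> C \<Longrightarrow> b c x \<le> 1" "\<And>c x. c \<in> C \<Longrightarrow> x \<in> ball c (r c) \<Longrightarrow> b c x = 1"
    "\<And>c x. c \<in> C \<Longrightarrow> x \<notin> cball c (2 * r c) \<Longrightarrow> b c x = (0::real)"
    by blast+
  \<comment> \<open>The product plays the role of a normalised sum: the result is 1 where some bump
    is 1, is 0 where all bumps vanish, and stays between 0 and 1.\<close>
  define \<psi> where "\<psi> = (\<lambda>x. 1 - (\<Prod>c\<in>C. 1 - b c x))"
  define S where "S = (\<Union>c\<in>C. cball c (2 * r c))"
  have S: "compact S"
    unfolding S_def using C(2) by (intro compact_UN) auto
  have SU: "S \<subseteq> U"
    unfolding S_def using C(1) r(2) by blast
  have supp: "{x. \<psi> x \<noteq> 0} \<subseteq> S"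
  proof
    fix x assume "x \<in> {x. \<psi> x \<noteq> 0}"
    then have "(\<Prod>c\<in>C. 1 - b c x) \<noteq> 1" by (simp add: \<psi>_def)
    then obtain c where "c \<in> C" "1 - b c x \<noteq> 1"
      by (rule prod.not_neutral_contains_not_neutral)
    with b(5)[of c x] show "x \<in> S" by (force simp: S_def)
  qed
  then have cl: "closure {x. \<psi> x \<noteq> 0} \<subseteq> S"
    using S by (simp add: closure_minimal compact_imp_closed)
  show thesis
  proof
    have "Ck k \<psi>" for k
      unfolding \<psi>_def using b(1) C(2)
      by (intro Ck_diff Ck_const Ck_prod) (auto simp: smooth_def)
    then show "smooth \<psi>" by (simp add: smooth_def)
    show "0 \<le> \<psi> x" for x
      using b by (auto simp: \<psi>_def intro!: prod_le_1)
    show "\<psi> x \<le> 1" for x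
      using b by (auto simp: \<psi>_def intro!: prod_nonneg)
    show "open (\<Union>x\<in>C. ball x (r x))" by auto
    show "K \<subseteq> (\<Union>x\<in>C. ball x (r x))" by (rule C)
    show "\<psi> x = 1" if "x \<in> (\<Union>x\<in>C. ball x (r x))" for x
    proof -
      from that obtain c where "c \<in> C" "x \<in> ball c (r c)" by blast
      then have "\<exists>c\<in>C. 1 - b c x = 0" using b(4) by force
      then show ?thesis using C(2) by (simp add: \<psi>_def prod_zero)
    qed
    show "compact (closure {x. \<psi> x \<noteq> 0})"
      using bounded_subset[OF compact_imp_bounded[OF S] supp] by (simp add: compact_closure)
    show "closure {x. \<psi> x \<noteq> 0} \<subseteq> U" using cl SU by blast
  qed
qed

section \<open>Integration over subsets\<close>

lemma
  fixes f :: "'a::euclidean_space \<Rightarrow> 'b::euclidean_space"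
  assumes "A \<in> sets lebesgue" "B \<in> sets lebesgue" "A \<subseteq> B" "\<And>x. x \<in> B - A \<Longrightarrow> f x = 0"
  shows integral_lebesgue_on_superset:
      "integral\<^sup>L (lebesgue_on B) f = integral\<^sup>L (lebesgue_on A) f"
    and integrable_lebesgue_on_superset:
      "integrable (lebesgue_on B) f \<longleftrightarrow> integrable (lebesgue_on A) f"
proof -
  have "(\<lambda>x. indicator B x *\<^sub>R f x) = (\<lambda>x. indicator A x *\<^sub>R f x)"
    using assms(3,4) by (auto simp: fun_eq_iff indicator_def)
  then show "integral\<^sup>L (lebesgue_on B) f = integral\<^sup>L (lebesgue_on A) f"
    "integrable (lebesgue_on B) f \<longleftrightarrow> integrable (lebesgue_on A) f"
    using assms(1,2) by (simp_all add: integral_restrict_space integrable_restrict_space)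
qed

lemma integrable_lebesgue_on_subset:
  fixes f :: "'a::euclidean_space \<Rightarrow> 'b::euclidean_space"
  assumes "integrable (lebesgue_on B) f" "A \<in> sets lebesgue" "B \<in> sets lebesgue" "A \<subseteq> B"
  shows "integrable (lebesgue_on A) f"
proof -
  have "integrable lebesgue (\<lambda>x. indicator B x *\<^sub>R f x)"
    using assms by (simp add: integrable_restrict_space)
  then have "integrable lebesgue (\<lambda>x. indicator A x *\<^sub>R indicator B x *\<^sub>R f x)"
    using assms(2) by (intro integrable_mult_indicator[of A]) auto
  moreover have "(\<lambda>x. indicator A x *\<^sub>R indicator B x *\<^sub>R f x) = (\<lambda>x. indicator A x *\<^sub>R f x)"
    using assms(4) by (auto simp: fun_eq_iff indicator_def)
  ultimately show ?thesis
    using assms(2) by (simp add: integrable_restrict_space)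
qed

lemma integrable_continuous_scaleR:
  fixes f :: "'a::euclidean_space \<Rightarrow> 'b::euclidean_space" and \<phi> :: "'a \<Rightarrow> real"
  assumes "continuous_on K \<phi>" "compact K" "integrable (lebesgue_on K) f"
  shows "integrable (lebesgue_on K) (\<lambda>z. \<phi> z *\<^sub>R f z)"
proof -
  have K: "K \<in> sets lebesgue" using assms(2) by (simp add: compact_imp_closed)
  obtain B where B: "\<And>z. z \<in> K \<Longrightarrow> norm (\<phi> z) \<le> B"
    using compact_imp_bounded[OF compact_continuous_image[OF assms(1,2)]]
    unfolding bounded_iff by auto
  have [measurable]: "\<phi> \<in> borel_measurable (lebesgue_on K)"
    using assms(1) K by (rule continuous_imp_measurable_on_sets_lebesgue)
  have [measurable]: "f \<in> borel_measurable (lebesgue_on K)"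
    using assms(3) by simp
  have "integrable (lebesgue_on K) (\<lambda>z. B *\<^sub>R norm (f z))"
    using assms(3) by simp
  then show ?thesis
  proof (rule Bochner_Integration.integrable_bound)
    have "norm (\<phi> z *\<^sub>R f z) \<le> norm (B *\<^sub>R norm (f z))" if "z \<in> K" for z
      using B[OF that] by (simp add: abs_mult) (meson abs_ge_self mult_right_mono norm_ge_zero order_trans)
    then show "AE z in lebesgue_on K. norm (\<phi> z *\<^sub>R f z) \<le> norm (B *\<^sub>R norm (f z))"
      using K by (auto intro!: AE_I2)
  qed measurable
qed

lemma integrable_compact_support_scaleR:
  fixes f :: "complex \<Rightarrow> 'a::euclidean_space" and \<phi> :: "complex \<Rightarrow> real"
  assumes "open \<Omega>" "locally_integrable \<Omega> f" "continuous_on UNIV \<phi>"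
    "compact K" "K \<subseteq> \<Omega>" "\<And>z. z \<notin> K \<Longrightarrow> \<phi> z = 0"
  shows "integrable (lebesgue_on \<Omega>) (\<lambda>z. \<phi> z *\<^sub>R f z)"
proof -
  have "integrable (lebesgue_on K) f"
    using assms by (simp add: locally_integrable_def)
  then have "integrable (lebesgue_on K) (\<lambda>z. \<phi> z *\<^sub>R f z)"
    using assms by (intro integrable_continuous_scaleR) (auto intro: continuous_on_subset)
  then show ?thesis
    using assms by (subst integrable_lebesgue_on_superset[of K]) (auto simp: compact_imp_closed)
qed

text \<open>Integrability is available on compact sets only, so \<open>f\<close> is reached as the
  pointwise limit of its truncations to a compact exhaustion; at each point of
  \<open>\<Omega>\<close> these are eventually constant.\<close>

lemma locally_integrable_borel_measurable:
  fixes f :: "complex \<Rightarrow> 'a::euclidean_space"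
  assumes "open \<Omega>" "locally_integrable \<Omega> f"
  shows "f \<in> borel_measurable (lebesgue_on \<Omega>)"
proof -
  obtain C where C: "\<And>n. compact (C n)" "\<And>n. C n \<subseteq> \<Omega>" "\<And>n. C n \<subseteq> interior (C (Suc n))"
    "\<Union>(range C) = \<Omega>" "\<And>K. compact K \<Longrightarrow> K \<subseteq> \<Omega> \<Longrightarrow> \<exists>N. \<forall>n\<ge>N. K \<subseteq> C n"
    by (rule open_Union_compact_subsets[OF assms(1)]) blast
  have "(\<lambda>x. indicator \<Omega> x *\<^sub>R f x) \<in> borel_measurable lebesgue"
  proof (rule borel_measurable_LIMSEQ_metric)
    show "(\<lambda>x. indicator (C n) x *\<^sub>R f x) \<in> borel_measurable lebesgue" for n
    proof -
      have "integrable (lebesgue_on (C n)) f"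
        using assms(2) C by (simp add: locally_integrable_def)
      then show ?thesis
        using C(1)[of n] by (simp add: integrable_restrict_space compact_imp_closed)
    qed
    show "(\<lambda>n. indicator (C n) x *\<^sub>R f x) \<longlonglongrightarrow> indicator \<Omega> x *\<^sub>R f x" for x
    proof (cases "x \<in> \<Omega>")
      case True
      then obtain N where "\<forall>n\<ge>N. x \<in> C n"
        using C(5)[of "{x}"] by auto
      with True show ?thesis
        by (intro tendsto_eventually eventually_sequentiallyI[of N]) simp
    next
      case False
      with C(2) have "x \<notin> C n" for n by blast
      with False show ?thesis by simp
    qed
  qed
  then show ?thesis
    using assms(1) by (simp add: borel_measurable_restrict_space_iff)
qed

text \<open>Measurability of \<open>g\<close> is a conclusion: preimages under the two functions,
  extended by zero, differ by a null set, and the Lebesgue sigma-algebra is complete.\<close>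

lemma borel_measurable_lebesgue_on_AE_cong:
  fixes f g :: "'a::euclidean_space \<Rightarrow> 'b::euclidean_space"
  assumes "f \<in> borel_measurable (lebesgue_on A)" "AE x in lebesgue_on A. f x = g x" "A \<in> sets lebesgue"
  shows "g \<in> borel_measurable (lebesgue_on A)"
proof -
  have A: "A \<inter> space lebesgue \<in> sets lebesgue" using assms(3) by simp
  have f: "(\<lambda>x. indicator A x *\<^sub>R f x) \<in> borel_measurable lebesgue" (is "?f \<in> _")
    using assms(1) A by (simp only: borel_measurable_restrict_space_iff)
  have ae: "AE x in lebesgue. indicator A x *\<^sub>R f x = indicator A x *\<^sub>R g x"
    using assms(2) A by (auto simp: AE_restrict_space_iff indicator_def elim: eventually_mono)
  have "(\<lambda>x. indicator A x *\<^sub>R g x) \<in> borel_measurable lebesgue" (is "?g \<in> _")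
  proof (rule borel_measurableI)
    fix S :: "'b set" assume "open S"
    then have 1: "?f -` S \<inter> space lebesgue \<in> sets lebesgue"
      using f by (intro measurable_sets[where A = borel]) auto
    have 2: "AE x in lebesgue. x \<in> ?f -` S \<inter> space lebesgue \<longleftrightarrow> x \<in> ?g -` S \<inter> space lebesgue"
      using ae by eventually_elim auto
    show "?g -` S \<inter> space lebesgue \<in> sets lebesgue"
      by (rule completion.in_sets_AE[OF 2 1]) simp
  qed
  then show ?thesis
    using A by (simp only: borel_measurable_restrict_space_iff)
qed

section \<open>Test functions\<close>

text \<open>One compact set serves \<open>\<phi>\<close> and its derivative: off the closed support,
  \<open>\<phi>\<close> is zero on a whole neighbourhood.\<close>

lemma test_functionE:
  assumes "\<phi> \<in> test_functions \<Omega>"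
  obtains K where "compact K" "K \<subseteq> \<Omega>" "\<And>z. z \<notin> K \<Longrightarrow> \<phi> z = 0"
    "\<And>z v. z \<notin> K \<Longrightarrow> frechet_derivative \<phi> (at z) v = 0"
proof
  let ?K = "closure {z. \<phi> z \<noteq> 0}"
  show "compact ?K" "?K \<subseteq> \<Omega>" using assms by (auto simp: test_functions_def)
  show *: "\<phi> z = 0" if "z \<notin> ?K" for z
    using that closure_subset[of "{z. \<phi> z \<noteq> 0}"] by blast
  show "frechet_derivative \<phi> (at z) v = 0" if "z \<notin> ?K" for z v
  proof -
    have "((\<lambda>_. 0) has_derivative (\<lambda>_. 0)) (at z)" by simp
    then have "(\<phi> has_derivative (\<lambda>_. 0)) (at z)"
    proof (rule has_derivative_transform_within_open)
      show "open (- ?K)" by (rule open_Compl[OF closed_closure])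
      show "z \<in> - ?K" using that by simp
      show "0 = \<phi> x" if "x \<in> - ?K" for x
        using *[OF ComplD[OF that]] by simp
    qed
    then have "frechet_derivative \<phi> (at z) = (\<lambda>_. 0)"
      by (rule frechet_derivative_at[symmetric])
    then show ?thesis by simp
  qed
qed

lemma test_function_smooth:
  assumes "\<phi> \<in> test_functions \<Omega>"
  shows "continuous_on UNIV \<phi>" "continuous_on UNIV (\<lambda>z. frechet_derivative \<phi> (at z) v)"
    "(\<phi> has_derivative frechet_derivative \<phi> (at z)) (at z)"
proof -
  have "Ck 0 \<phi>" "Ck (Suc 0) \<phi>" using assms unfolding test_functions_def smooth_def by blast+
  then show "continuous_on UNIV \<phi>" "continuous_on UNIV (\<lambda>z. frechet_derivative \<phi> (at z) v)"
    "(\<phi> has_derivative frechet_derivative \<phi> (at z)) (at z)"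
    by (auto simp: frechet_derivative_works[symmetric])
qed

lemma test_functions_mono: "\<Omega> \<subseteq> \<Omega>' \<Longrightarrow> test_functions \<Omega> \<subseteq> test_functions \<Omega>'"
  by (auto simp: test_functions_def)

lemma test_functionI:
  assumes "smooth \<phi>" "compact K" "K \<subseteq> \<Omega>" "\<And>z. z \<notin> K \<Longrightarrow> \<phi> z = 0"
  shows "\<phi> \<in> test_functions \<Omega>"
proof -
  have sub: "{z. \<phi> z \<noteq> 0} \<subseteq> K" using assms(4) by blast
  then have "closure {z. \<phi> z \<noteq> 0} \<subseteq> K"
    using assms(2) by (simp add: closure_minimal compact_imp_closed)
  moreover have "compact (closure {z. \<phi> z \<noteq> 0})"
    using bounded_subset[OF compact_imp_bounded[OF assms(2)] sub] by (simp add: compact_closure)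
  ultimately show ?thesis
    using assms by (auto simp: test_functions_def)
qed

lemma integral_test_function:
  fixes f :: "complex \<Rightarrow> 'a::euclidean_space"
  assumes "open \<Omega>" "\<phi> \<in> test_functions \<Omega>" "locally_integrable \<Omega> f"
  shows "integrable (lebesgue_on \<Omega>) (\<lambda>z. \<phi> z *\<^sub>R f z)"
    and "integrable (lebesgue_on \<Omega>) (\<lambda>z. frechet_derivative \<phi> (at z) v *\<^sub>R f z)"
proof -
  obtain K where K: "compact K" "K \<subseteq> \<Omega>" "\<And>z. z \<notin> K \<Longrightarrow> \<phi> z = 0"
    "\<And>z v. z \<notin> K \<Longrightarrow> frechet_derivative \<phi> (at z) v = 0"
    by (rule test_functionE[OF assms(2)]) blast
  show "integrable (lebesgue_on \<Omega>) (\<lambda>z. \<phi> z *\<^sub>R f z)"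
    "integrable (lebesgue_on \<Omega>) (\<lambda>z. frechet_derivative \<phi> (at z) v *\<^sub>R f z)"
    by (rule integrable_compact_support_scaleR[OF assms(1,3) _ K(1,2)];
      use K test_function_smooth[OF assms(2)] in auto)+
qed

lemma integral_test_function_superset:
  fixes f :: "complex \<Rightarrow> 'a::euclidean_space"
  assumes "open \<Omega>" "open \<Omega>'" "\<Omega> \<subseteq> \<Omega>'" "\<phi> \<in> test_functions \<Omega>"
  shows "(LINT z|lebesgue_on \<Omega>'. \<phi> z *\<^sub>R f z) = (LINT z|lebesgue_on \<Omega>. \<phi> z *\<^sub>R f z)"
    and "(LINT z|lebesgue_on \<Omega>'. frechet_derivative \<phi> (at z) v *\<^sub>R f z)
      = (LINT z|lebesgue_on \<Omega>. frechet_derivative \<phi> (at z) v *\<^sub>R f z)"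
proof -
  obtain K where K: "compact K" "K \<subseteq> \<Omega>" "\<And>z. z \<notin> K \<Longrightarrow> \<phi> z = 0"
    "\<And>z v. z \<notin> K \<Longrightarrow> frechet_derivative \<phi> (at z) v = 0"
    by (rule test_functionE[OF assms(4)]) blast
  show "(LINT z|lebesgue_on \<Omega>'. \<phi> z *\<^sub>R f z) = (LINT z|lebesgue_on \<Omega>. \<phi> z *\<^sub>R f z)"
    "(LINT z|lebesgue_on \<Omega>'. frechet_derivative \<phi> (at z) v *\<^sub>R f z)
      = (LINT z|lebesgue_on \<Omega>. frechet_derivative \<phi> (at z) v *\<^sub>R f z)"
    by (rule integral_lebesgue_on_superset; use assms K in \<open>auto intro!: K(4)\<close>)+
qed

section \<open>The fundamental lemma of the calculus of variations\<close>

text \<open>Test functions equal to 1 on \<open>C\<close> and supported ever closer to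
  \<open>C\<close> tend pointwise to its indicator; dominated convergence carries the vanishing
  integrals to the limit.\<close>

lemma integral_compact_eq_0:
  fixes g :: "complex \<Rightarrow> 'a::euclidean_space"
  assumes "open \<Omega>" "locally_integrable \<Omega> g"
    and zero: "\<And>\<phi>. \<phi> \<in> test_functions \<Omega> \<Longrightarrow> (LINT z|lebesgue_on \<Omega>. \<phi> z *\<^sub>R g z) = 0"
    and C: "compact C" "C \<subseteq> \<Omega>"
  shows "(LINT z|lebesgue_on C. g z) = 0"
\<comment> \<open>The empty set is separated because \<open>infdist z {}\<close> is 0 by convention,
  so the distance would not detect points outside it.\<close>
proof (cases "C = {}")
  case False
  obtain \<psi> :: "complex \<Rightarrow> real" and V where V: "open V" "C \<subseteq> V" "\<And>x. x \<in> V \<Longrightarrow> \<psi> x = 1"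
    and L: "compact (closure {x. \<psi> x \<noteq> 0})" "closure {x. \<psi> x \<noteq> 0} \<subseteq> \<Omega>"
    by (rule smooth_cutoff[OF C(1) assms(1) C(2)]) blast
  \<comment> \<open>As \<open>g\<close> is integrable over compact subsets only, all supports must
    lie in one compact set before \<open>norm (g z)\<close> can dominate. The cut-off
    \<open>\<psi>\<close> is there to produce such an \<open>L\<close> around an open
    \<open>V\<close>.\<close>
  define L where "L = closure {x. \<psi> x \<noteq> 0}"
  have VL: "V \<subseteq> L" unfolding L_def using V(3) closure_subset[of "{x. \<psi> x \<noteq> 0}"] by force
  have L: "compact L" "L \<subseteq> \<Omega>" using L by (auto simp: L_def)
  have Lm: "L \<in> sets lebesgue" "C \<in> sets lebesgue" using L C by (auto simp: compact_imp_closed)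
  have "\<exists>\<phi>. \<phi> \<in> test_functions \<Omega> \<and> (\<forall>z. 0 \<le> \<phi> z \<and> \<phi> z \<le> 1) \<and> (\<forall>z\<in>C. \<phi> z = 1) \<and>
      (\<forall>z. z \<notin> V \<or> infdist z C \<ge> 1 / Suc n \<longrightarrow> \<phi> z = 0)" for n
  proof -
    let ?U = "V \<inter> {z. infdist z C < 1 / Suc n}"
    have "open ?U"
      using V(1) by (intro open_Int open_Collect_less continuous_intros)
    moreover have "C \<subseteq> ?U" using V(2) by auto
    ultimately obtain \<phi> :: "complex \<Rightarrow> real" and W where \<phi>: "smooth \<phi>" "\<And>x. 0 \<le> \<phi> x" "\<And>x. \<phi> x \<le> 1"
      "C \<subseteq> W" "\<And>x. x \<in> W \<Longrightarrow> \<phi> x = 1"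
      "compact (closure {x. \<phi> x \<noteq> 0})" "closure {x. \<phi> x \<noteq> 0} \<subseteq> ?U"
      by (rule smooth_cutoff[OF C(1)]) blast
    have "\<phi> \<in> test_functions \<Omega>"
      using \<phi>(1,6,7) VL L(2) by (auto simp: test_functions_def)
    moreover have "\<phi> z = 0" if "z \<notin> V \<or> infdist z C \<ge> 1 / Suc n" for z
      using \<phi>(7) closure_subset[of "{x. \<phi> x \<noteq> 0}"] that by fastforce
    moreover have "\<phi> z = 1" if "z \<in> C" for z
      using \<phi>(4,5) that by blast
    ultimately show ?thesis
      using \<phi>(2,3) by (intro exI[of _ \<phi>]) auto
  qed
  then have "\<forall>n. \<exists>\<phi>. \<phi> \<in> test_functions \<Omega> \<and> (\<forall>z. 0 \<le> \<phi> z \<and> \<phi> z \<le> 1) \<and> (\<forall>z\<in>C. \<phi> z = 1) \<and>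
      (\<forall>z. z \<notin> V \<or> infdist z C \<ge> 1 / Suc n \<longrightarrow> \<phi> z = 0)" ..
  from choice[OF this] obtain \<phi> where "\<forall>n. \<phi> n \<in> test_functions \<Omega> \<and>
      (\<forall>z. 0 \<le> \<phi> n z \<and> \<phi> n z \<le> 1) \<and> (\<forall>z\<in>C. \<phi> n z = 1) \<and>
      (\<forall>z. z \<notin> V \<or> infdist z C \<ge> 1 / Suc n \<longrightarrow> \<phi> n z = 0)" ..
  then have \<phi>: "\<phi> n \<in> test_functions \<Omega>" "0 \<le> \<phi> n z" "\<phi> n z \<le> 1" "z \<in> C \<Longrightarrow> \<phi> n z = 1"
      "z \<notin> V \<Longrightarrow> \<phi> n z = 0" "infdist z C \<ge> 1 / Suc n \<Longrightarrow> \<phi> n z = 0" for n z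
    by blast+
  have gL: "integrable (lebesgue_on L) g"
    using assms(2) L by (simp add: locally_integrable_def)
  have [measurable]: "g \<in> borel_measurable (lebesgue_on L)" using gL by simp
  have lim: "(\<lambda>n. \<phi> n z) \<longlonglongrightarrow> indicator C z" for z
  proof (cases "z \<in> C")
    case True
    then show ?thesis using \<phi>(4) by simp
  next
    case z: False
    then have "infdist z C > 0"
      using C(1) False by (metis compact_imp_closed in_closed_iff_infdist_zero infdist_nonneg less_le)
    then have "eventually (\<lambda>n. 1 / real (Suc n) < infdist z C) sequentially"
      using LIMSEQ_inverse_real_of_nat by (auto simp: inverse_eq_divide dest: order_tendstoD)
    then have "eventually (\<lambda>n. \<phi> n z = indicator C z) sequentially"
      by eventually_elim (use z \<phi>(6) in auto)
    then show ?thesis by (rule tendsto_eventually)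
  qed
  have "(\<lambda>n. LINT z|lebesgue_on L. \<phi> n z *\<^sub>R g z) \<longlonglongrightarrow> (LINT z|lebesgue_on L. indicator C z *\<^sub>R g z)"
  proof (rule integral_dominated_convergence)
    show "(\<lambda>z. indicator C z *\<^sub>R g z) \<in> borel_measurable (lebesgue_on L)"
    proof -
      have "C \<inter> L \<in> sets (lebesgue_on L)"
        using Lm by (auto simp: sets_restrict_space)
      moreover have "C \<inter> L = C" using V(2) VL by auto
      ultimately have [measurable]: "C \<in> sets (lebesgue_on L)" by simp
      show ?thesis by measurable
    qed
    show "(\<lambda>z. \<phi> n z *\<^sub>R g z) \<in> borel_measurable (lebesgue_on L)" for n
    proof -
      have [measurable]: "\<phi> n \<in> borel_measurable (lebesgue_on L)"
        using test_function_smooth(1)[OF \<phi>(1)] Lm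
        by (intro continuous_imp_measurable_on_sets_lebesgue) (auto intro: continuous_on_subset)
      show ?thesis by measurable
    qed
    show "integrable (lebesgue_on L) (\<lambda>z. norm (g z))" using gL by simp
    show "AE z in lebesgue_on L. (\<lambda>n. \<phi> n z *\<^sub>R g z) \<longlonglongrightarrow> indicator C z *\<^sub>R g z"
      using lim by (intro AE_I2 tendsto_intros)
    show "AE z in lebesgue_on L. norm (\<phi> n z *\<^sub>R g z) \<le> norm (g z)" for n
      using \<phi>(2,3) by (intro AE_I2) (simp add: mult_left_le_one_le)
  qed
  moreover have "(LINT z|lebesgue_on L. \<phi> n z *\<^sub>R g z) = 0" for n
  proof -
    have "(LINT z|lebesgue_on \<Omega>. \<phi> n z *\<^sub>R g z) = (LINT z|lebesgue_on L. \<phi> n z *\<^sub>R g z)"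
      using Lm L assms(1) \<phi>(5) VL by (intro integral_lebesgue_on_superset) auto
    with zero[OF \<phi>(1)] show ?thesis by simp
  qed
  ultimately have "(LINT z|lebesgue_on L. indicator C z *\<^sub>R g z) = 0"
    by (simp add: LIMSEQ_const_iff)
  moreover have "(LINT z|lebesgue_on L. indicator C z *\<^sub>R g z) = (LINT z|lebesgue_on C. indicator C z *\<^sub>R g z)"
    using Lm V(2) VL by (intro integral_lebesgue_on_superset) auto
  moreover have "\<dots> = (LINT z|lebesgue_on C. g z)"
    using Lm by (intro Bochner_Integration.integral_cong) auto
  ultimately show ?thesis by simp
qed simp

text \<open>Inner regularity: up to a null set, the set where \<open>g\<close> is positive is a
  countable union of compact sets. On each of them a positive function has integral 0, so each is
  null.\<close>

lemma AE_nonpos_if_integral_compact_eq_0: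
  fixes g :: "complex \<Rightarrow> real"
  assumes "open \<Omega>" "locally_integrable \<Omega> g"
    and zero: "\<And>C. compact C \<Longrightarrow> C \<subseteq> \<Omega> \<Longrightarrow> (LINT z|lebesgue_on C. g z) = 0"
  shows "AE z in lebesgue_on \<Omega>. g z \<le> 0"
proof -
  define S where "S = {z \<in> \<Omega>. g z > 0}"
  have [measurable]: "g \<in> borel_measurable (lebesgue_on \<Omega>)"
    using assms by (intro locally_integrable_borel_measurable)
  have "{z \<in> space (lebesgue_on \<Omega>). g z > 0} \<in> sets (lebesgue_on \<Omega>)" by measurable
  then have "S \<in> sets lebesgue"
    using assms(1) by (simp add: S_def sets_restrict_space_iff)
  then obtain F N where F: "fsigma F" "N \<in> null_sets lebesgue" "F \<union> N = S"
    by (rule lebesgue_set_almost_fsigma)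
  obtain C :: "nat \<Rightarrow> complex set" where C: "range C \<subseteq> Collect compact" "F = \<Union>(range C)"
    using F(1) fsigma_Union_compact by metis
  have "C n \<in> null_sets lebesgue" for n
  proof -
    have Cn: "compact (C n)" "C n \<subseteq> S" "C n \<subseteq> \<Omega>"
      using C F(3) by (auto simp: S_def)
    have m: "C n \<in> sets lebesgue" using Cn by (simp add: compact_imp_closed)
    have "integrable (lebesgue_on (C n)) g"
      using assms(2) Cn by (simp add: locally_integrable_def)
    moreover have "AE z in lebesgue_on (C n). 0 \<le> g z"
      using Cn(2) m by (intro AE_I2) (auto simp: S_def)
    ultimately have "AE z in lebesgue_on (C n). g z = 0"
      using zero[OF Cn(1,3)] by (simp add: integral_nonneg_eq_0_iff_AE)
    then have "AE z in lebesgue. z \<in> C n \<longrightarrow> g z = 0"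
      using m by (simp add: AE_restrict_space_iff)
    then have "AE z in lebesgue. z \<notin> C n"
      by eventually_elim (use Cn(2) in \<open>auto simp: S_def\<close>)
    then show ?thesis
      using m by (simp add: AE_iff_null_sets)
  qed
  then have "F \<in> null_sets lebesgue" unfolding C(2) by blast
  then have "S \<in> null_sets lebesgue"
    unfolding F(3)[symmetric] using F(2) by (rule null_sets.Un)
  then have "AE z in lebesgue. z \<notin> S" by (rule AE_not_in)
  then show ?thesis
    using assms(1) by (auto simp: AE_restrict_space_iff S_def elim: eventually_mono)
qed

lemma locally_integrable_inner:
  "locally_integrable \<Omega> f \<Longrightarrow> locally_integrable \<Omega> (\<lambda>z. f z \<bullet> i)"
  unfolding locally_integrable_def by (intro allI impI integrable_inner_left) auto

text \<open>The one-sided result, applied to the components along both \<open>i\<close> and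
  \<open>- i\<close>, yields equality coordinate by coordinate.\<close>

lemma AE_eq_0_if_test_functions:
  fixes g :: "complex \<Rightarrow> 'a::euclidean_space"
  assumes "open \<Omega>" "locally_integrable \<Omega> g"
    and "\<And>\<phi>. \<phi> \<in> test_functions \<Omega> \<Longrightarrow> (LINT z|lebesgue_on \<Omega>. \<phi> z *\<^sub>R g z) = 0"
  shows "AE z in lebesgue_on \<Omega>. g z = 0"
proof -
  have le: "AE z in lebesgue_on \<Omega>. g z \<bullet> i \<le> 0" for i
  proof (rule AE_nonpos_if_integral_compact_eq_0[OF assms(1)])
    show "locally_integrable \<Omega> (\<lambda>z. g z \<bullet> i)"
      using assms(2) by (rule locally_integrable_inner)
    show "(LINT z|lebesgue_on C. g z \<bullet> i) = 0" if C: "compact C" "C \<subseteq> \<Omega>" for C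
    proof -
      have "integrable (lebesgue_on C) g"
        using assms(2) C by (simp add: locally_integrable_def)
      then show ?thesis
        using integral_compact_eq_0[OF assms C] by (simp add: integral_inner_left)
    qed
  qed
  have "AE z in lebesgue_on \<Omega>. \<forall>i\<in>Basis. g z \<bullet> i \<le> 0 \<and> g z \<bullet> - i \<le> 0"
    using le le[of "- i" for i] by (intro AE_finite_allI AE_conjI) (auto simp del: inner_minus_right)
  then show ?thesis
  proof eventually_elim
    case (elim z)
    then have "\<forall>i\<in>Basis. g z \<bullet> i = 0" by (auto intro: antisym)
    then show ?case by (metis euclidean_eqI inner_zero_left)
  qed
qed

section \<open>Weak derivatives\<close>

lemma locally_integrable_subset:
  "locally_integrable \<Omega> f \<Longrightarrow> \<Omega>' \<subseteq> \<Omega> \<Longrightarrow> locally_integrable \<Omega>' f"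
  unfolding locally_integrable_def by blast

lemma locally_integrable_diff:
  "locally_integrable \<Omega> f \<Longrightarrow> locally_integrable \<Omega> g \<Longrightarrow> locally_integrable \<Omega> (\<lambda>z. f z - g z)"
  unfolding locally_integrable_def by simp

lemma AE_lebesgue_on_subset:
  assumes "AE x in lebesgue_on B. P x" "A \<subseteq> B" "A \<in> sets lebesgue" "B \<in> sets lebesgue"
  shows "AE x in lebesgue_on A. P x"
proof -
  have "AE x in lebesgue. x \<in> B \<longrightarrow> P x"
    using assms by (simp add: AE_restrict_space_iff)
  then have "AE x in lebesgue. x \<in> A \<longrightarrow> P x"
    by eventually_elim (use assms(2) in blast)
  then show ?thesis
    using assms by (simp add: AE_restrict_space_iff)
qed

lemma AE_lebesgue_on_Un:
  assumes "AE x in lebesgue_on A. P x" "AE x in lebesgue_on B. P x"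
    "A \<in> sets lebesgue" "B \<in> sets lebesgue"
  shows "AE x in lebesgue_on (A \<union> B). P x"
proof -
  have "AE x in lebesgue. x \<in> A \<longrightarrow> P x" "AE x in lebesgue. x \<in> B \<longrightarrow> P x"
    using assms by (simp_all add: AE_restrict_space_iff)
  then have "AE x in lebesgue. x \<in> A \<union> B \<longrightarrow> P x"
    by eventually_elim blast
  then show ?thesis
    using assms by (simp add: AE_restrict_space_iff)
qed

lemma integrable_lebesgue_on_AE_cong:
  fixes f g :: "'a::euclidean_space \<Rightarrow> 'b::euclidean_space"
  assumes "integrable (lebesgue_on A) f" "AE x in lebesgue_on A. f x = g x" "A \<in> sets lebesgue"
  shows "integrable (lebesgue_on A) g"
proof -
  have "f \<in> borel_measurable (lebesgue_on A)" using assms(1) by simp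
  moreover from this have "g \<in> borel_measurable (lebesgue_on A)"
    using assms(2,3) by (rule borel_measurable_lebesgue_on_AE_cong)
  ultimately show ?thesis
    using assms(1,2) integrable_cong_AE[of f "lebesgue_on A" g] by blast
qed

lemma locally_integrable_AE_cong:
  fixes f g :: "complex \<Rightarrow> 'a::euclidean_space"
  assumes "open \<Omega>" "locally_integrable \<Omega> f" "AE z in lebesgue_on \<Omega>. f z = g z"
  shows "locally_integrable \<Omega> g"
  unfolding locally_integrable_def
proof (intro allI impI)
  fix K assume K: "compact K \<and> K \<subseteq> \<Omega>"
  then have Km: "K \<in> sets lebesgue" by (simp add: compact_imp_closed)
  have "AE z in lebesgue_on K. f z = g z"
    using AE_lebesgue_on_subset[OF assms(3)] K Km assms(1) by simp
  moreover have "integrable (lebesgue_on K) f"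
    using assms(2) K by (simp add: locally_integrable_def)
  ultimately show "integrable (lebesgue_on K) g"
    using Km integrable_lebesgue_on_AE_cong[of K f g] by blast
qed

section \<open>Uniqueness and locality of weak derivatives\<close>

text \<open>This gives \<open>weak_deriv\<close> its meaning: whichever function the choice operator
  returns, it is the same up to a null set.\<close>

lemma has_weak_deriv_unique:
  fixes f :: "complex \<Rightarrow> 'a::euclidean_space"
  assumes "open \<Omega>" "has_weak_deriv \<Omega> f v g" "has_weak_deriv \<Omega> f v g'"
  shows "AE z in lebesgue_on \<Omega>. g z = g' z"
proof -
  have li: "locally_integrable \<Omega> g" "locally_integrable \<Omega> g'"
    using assms by (auto simp: has_weak_deriv_def)
  have "AE z in lebesgue_on \<Omega>. g z - g' z = 0"
  proof (rule AE_eq_0_if_test_functions[OF assms(1) locally_integrable_diff[OF li]])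
    fix \<phi> assume \<phi>: "\<phi> \<in> test_functions \<Omega>"
    then have "(LINT z|lebesgue_on \<Omega>. \<phi> z *\<^sub>R g z) = (LINT z|lebesgue_on \<Omega>. \<phi> z *\<^sub>R g' z)"
      using assms(2,3) unfolding has_weak_deriv_def by (metis neg_equal_iff_equal)
    then show "(LINT z|lebesgue_on \<Omega>. \<phi> z *\<^sub>R (g z - g' z)) = 0"
      using integral_test_function(1)[OF assms(1) \<phi> li(1)] integral_test_function(1)[OF assms(1) \<phi> li(2)]
      by (simp add: scaleR_diff_right)
  qed
  then show ?thesis by simp
qed

text \<open>Test functions of the smaller set are test functions of the larger one, and the
  integrals see only their support.\<close>

lemma has_weak_deriv_subset:
  fixes f :: "complex \<Rightarrow> 'a::euclidean_space"
  assumes "open \<Omega>" "open \<Omega>'" "\<Omega>' \<subseteq> \<Omega>" "has_weak_deriv \<Omega> f v g"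
  shows "has_weak_deriv \<Omega>' f v g"
  unfolding has_weak_deriv_def
proof (intro conjI ballI)
  show "locally_integrable \<Omega>' f" "locally_integrable \<Omega>' g"
    using assms locally_integrable_subset by (auto simp: has_weak_deriv_def)
  fix \<phi> assume \<phi>: "\<phi> \<in> test_functions \<Omega>'"
  then have "\<phi> \<in> test_functions \<Omega>"
    using test_functions_mono assms(3) by blast
  then have "(LINT z|lebesgue_on \<Omega>. frechet_derivative \<phi> (at z) v *\<^sub>R f z)
      = - (LINT z|lebesgue_on \<Omega>. \<phi> z *\<^sub>R g z)"
    using assms(4) by (simp add: has_weak_deriv_def)
  then show "(LINT z|lebesgue_on \<Omega>'. frechet_derivative \<phi> (at z) v *\<^sub>R f z)
      = - (LINT z|lebesgue_on \<Omega>'. \<phi> z *\<^sub>R g z)"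
    by (simp only: integral_test_function_superset[OF assms(2,1,3) \<phi>])
qed

lemma has_weak_deriv_diff:
  fixes f :: "complex \<Rightarrow> 'a::euclidean_space"
  assumes "open \<Omega>" "has_weak_deriv \<Omega> f v f'" "has_weak_deriv \<Omega> g v g'"
  shows "has_weak_deriv \<Omega> (\<lambda>z. f z - g z) v (\<lambda>z. f' z - g' z)"
  unfolding has_weak_deriv_def
proof (intro conjI ballI)
  have li: "locally_integrable \<Omega> f" "locally_integrable \<Omega> g"
    "locally_integrable \<Omega> f'" "locally_integrable \<Omega> g'"
    using assms by (auto simp: has_weak_deriv_def)
  then show "locally_integrable \<Omega> (\<lambda>z. f z - g z)" "locally_integrable \<Omega> (\<lambda>z. f' z - g' z)"
    by (auto intro: locally_integrable_diff)
  fix \<phi> assume \<phi>: "\<phi> \<in> test_functions \<Omega>"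
  show "(LINT z|lebesgue_on \<Omega>. frechet_derivative \<phi> (at z) v *\<^sub>R (f z - g z))
      = - (LINT z|lebesgue_on \<Omega>. \<phi> z *\<^sub>R (f' z - g' z))"
    using integral_test_function(2)[OF assms(1) \<phi> li(1)] integral_test_function(2)[OF assms(1) \<phi> li(2)]
      integral_test_function(1)[OF assms(1) \<phi> li(3)] integral_test_function(1)[OF assms(1) \<phi> li(4)]
      assms(2,3) \<phi>
    by (simp add: scaleR_diff_right has_weak_deriv_def)
qed

lemma has_weak_deriv_AE_cong:
  fixes f :: "complex \<Rightarrow> 'a::euclidean_space"
  assumes "open \<Omega>" "has_weak_deriv \<Omega> f v f'"
    "AE z in lebesgue_on \<Omega>. f z = g z" "AE z in lebesgue_on \<Omega>. f' z = g' z"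
  shows "has_weak_deriv \<Omega> g v g'"
  unfolding has_weak_deriv_def
proof (intro conjI ballI)
  have li: "locally_integrable \<Omega> f" "locally_integrable \<Omega> f'"
    using assms by (auto simp: has_weak_deriv_def)
  show li': "locally_integrable \<Omega> g" "locally_integrable \<Omega> g'"
    using assms(1) li assms(3,4) by (blast intro: locally_integrable_AE_cong)+
  fix \<phi> assume \<phi>: "\<phi> \<in> test_functions \<Omega>"
  have "(LINT z|lebesgue_on \<Omega>. frechet_derivative \<phi> (at z) v *\<^sub>R g z)
      = (LINT z|lebesgue_on \<Omega>. frechet_derivative \<phi> (at z) v *\<^sub>R f z)"
    using integral_test_function(2)[OF assms(1) \<phi> li(1)] integral_test_function(2)[OF assms(1) \<phi> li'(1)] assms(3)
    by (intro integral_cong_AE borel_measurable_integrable) (auto elim: eventually_mono)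
  also have "\<dots> = - (LINT z|lebesgue_on \<Omega>. \<phi> z *\<^sub>R f' z)"
    using assms(2) \<phi> by (simp add: has_weak_deriv_def)
  also have "(LINT z|lebesgue_on \<Omega>. \<phi> z *\<^sub>R f' z) = (LINT z|lebesgue_on \<Omega>. \<phi> z *\<^sub>R g' z)"
    using integral_test_function(1)[OF assms(1) \<phi> li(2)] integral_test_function(1)[OF assms(1) \<phi> li'(2)] assms(4)
    by (intro integral_cong_AE borel_measurable_integrable) (auto elim: eventually_mono)
  finally show "(LINT z|lebesgue_on \<Omega>. frechet_derivative \<phi> (at z) v *\<^sub>R g z)
      = - (LINT z|lebesgue_on \<Omega>. \<phi> z *\<^sub>R g' z)" .
qed

text \<open>A two-piece partition of unity: \<open>\<phi>\<close> is the sum of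
  \<open>\<psi> * \<phi>\<close> and \<open>(1 - \<psi>) * \<phi>\<close>, where
  \<open>\<psi>\<close> is supported in \<open>\<Omega>\<^sub>1\<close> and equals 1 near the part
  of the support of \<open>\<phi>\<close> that \<open>\<Omega>\<^sub>2\<close> misses. Local
  integrability on the union is a hypothesis here; for \<open>Lp\<close> maps it comes from
  \<open>Lp_locally_integrable\<close>.\<close>

lemma has_weak_deriv_Un:
  fixes f :: "complex \<Rightarrow> 'a::euclidean_space"
  assumes op: "open \<Omega>\<^sub>1" "open \<Omega>\<^sub>2"
    and wd: "has_weak_deriv \<Omega>\<^sub>1 f v g" "has_weak_deriv \<Omega>\<^sub>2 f v g"
    and li: "locally_integrable (\<Omega>\<^sub>1 \<union> \<Omega>\<^sub>2) f" "locally_integrable (\<Omega>\<^sub>1 \<union> \<Omega>\<^sub>2) g"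
  shows "has_weak_deriv (\<Omega>\<^sub>1 \<union> \<Omega>\<^sub>2) f v g"
  unfolding has_weak_deriv_def
proof (intro conjI ballI li)
  let ?\<Omega> = "\<Omega>\<^sub>1 \<union> \<Omega>\<^sub>2"
  let ?D = "\<lambda>\<phi> z. frechet_derivative \<phi> (at z) v"
  have opU: "open ?\<Omega>" using op by (rule open_Un)
  have part: "(LINT z|lebesgue_on ?\<Omega>. ?D \<phi> z *\<^sub>R f z) = - (LINT z|lebesgue_on ?\<Omega>. \<phi> z *\<^sub>R g z)"
    if "\<phi> \<in> test_functions \<Omega>" "open \<Omega>" "\<Omega> \<subseteq> ?\<Omega>" "has_weak_deriv \<Omega> f v g" for \<phi> \<Omega>
    using that by (simp add: integral_test_function_superset[OF that(2) opU that(3,1)] has_weak_deriv_def)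
  fix \<phi> assume \<phi>: "\<phi> \<in> test_functions ?\<Omega>"
  then have sm: "smooth \<phi>" by (simp add: test_functions_def)
  obtain K where K: "compact K" "K \<subseteq> ?\<Omega>" "\<And>z. z \<notin> K \<Longrightarrow> \<phi> z = 0"
    by (rule test_functionE[OF \<phi>]) blast
  have "compact (K - \<Omega>\<^sub>2)" "K - \<Omega>\<^sub>2 \<subseteq> \<Omega>\<^sub>1"
    using K op by (auto intro: compact_diff)
  then obtain \<psi> :: "complex \<Rightarrow> real" and V where \<psi>: "smooth \<psi>" "open V" "K - \<Omega>\<^sub>2 \<subseteq> V"
    "\<And>x. x \<in> V \<Longrightarrow> \<psi> x = 1" "compact (closure {x. \<psi> x \<noteq> 0})" "closure {x. \<psi> x \<noteq> 0} \<subseteq> \<Omega>\<^sub>1"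
    using smooth_cutoff[OF _ op(1)] by metis
  define \<phi>\<^sub>1 where "\<phi>\<^sub>1 = (\<lambda>z. \<psi> z * \<phi> z)"
  define \<phi>\<^sub>2 where "\<phi>\<^sub>2 = (\<lambda>z. (1 - \<psi> z) * \<phi> z)"
  have t1: "\<phi>\<^sub>1 \<in> test_functions \<Omega>\<^sub>1"
  proof (rule test_functionI)
    show "smooth \<phi>\<^sub>1" unfolding \<phi>\<^sub>1_def using \<psi>(1) sm by (rule smooth_mult)
    show "\<phi>\<^sub>1 z = 0" if "z \<notin> closure {x. \<psi> x \<noteq> 0}" for z
      using that closure_subset[of "{x. \<psi> x \<noteq> 0}"] by (auto simp: \<phi>\<^sub>1_def)
  qed (fact \<psi>(5,6))+
  have t2: "\<phi>\<^sub>2 \<in> test_functions \<Omega>\<^sub>2"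
  proof (rule test_functionI)
    show "smooth \<phi>\<^sub>2" unfolding \<phi>\<^sub>2_def using \<psi>(1) sm by (intro smooth_mult smooth_diff smooth_const)
    \<comment> \<open>On \<open>V\<close> the factor \<open>1 - \<psi>\<close> is zero, and what
      \<open>V\<close> leaves of \<open>K\<close> lies in \<open>\<Omega>\<^sub>2\<close> by the
      choice of \<open>V\<close>.\<close>
    show "compact (K - V)" using K(1) \<psi>(2) by (rule compact_diff)
    show "K - V \<subseteq> \<Omega>\<^sub>2" using \<psi>(3) by blast
    show "\<phi>\<^sub>2 z = 0" if "z \<notin> K - V" for z
      using that K(3)[of z] \<psi>(4)[of z] by (auto simp: \<phi>\<^sub>2_def)
  qed
  have sum: "\<phi> z = \<phi>\<^sub>1 z + \<phi>\<^sub>2 z" for z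
    by (simp add: \<phi>\<^sub>1_def \<phi>\<^sub>2_def algebra_simps)
  have Dsum: "?D \<phi> z = ?D \<phi>\<^sub>1 z + ?D \<phi>\<^sub>2 z" for z
  proof -
    have "((\<lambda>z. \<phi>\<^sub>1 z + \<phi>\<^sub>2 z) has_derivative
        (\<lambda>v. frechet_derivative \<phi>\<^sub>1 (at z) v + frechet_derivative \<phi>\<^sub>2 (at z) v)) (at z)"
      using test_function_smooth(3)[OF t1] test_function_smooth(3)[OF t2] by (rule has_derivative_add)
    then have "(\<phi> has_derivative
        (\<lambda>v. frechet_derivative \<phi>\<^sub>1 (at z) v + frechet_derivative \<phi>\<^sub>2 (at z) v)) (at z)"
      by (simp only: sum[symmetric])
    from frechet_derivative_at[OF this] show ?thesis by metis
  qed
  have tU: "\<phi>\<^sub>1 \<in> test_functions ?\<Omega>" "\<phi>\<^sub>2 \<in> test_functions ?\<Omega>"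
    using t1 t2 test_functions_mono[of _ ?\<Omega>] by blast+
  have "(LINT z|lebesgue_on ?\<Omega>. ?D \<phi> z *\<^sub>R f z)
      = (LINT z|lebesgue_on ?\<Omega>. ?D \<phi>\<^sub>1 z *\<^sub>R f z) + (LINT z|lebesgue_on ?\<Omega>. ?D \<phi>\<^sub>2 z *\<^sub>R f z)"
    using integral_test_function(2)[OF opU tU(1) li(1)] integral_test_function(2)[OF opU tU(2) li(1)]
    by (simp add: Dsum scaleR_add_left)
  also have "\<dots> = - (LINT z|lebesgue_on ?\<Omega>. \<phi>\<^sub>1 z *\<^sub>R g z) - (LINT z|lebesgue_on ?\<Omega>. \<phi>\<^sub>2 z *\<^sub>R g z)"
    using part[OF t1 op(1) _ wd(1)] part[OF t2 op(2) _ wd(2)] by simp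
  also have "\<dots> = - (LINT z|lebesgue_on ?\<Omega>. \<phi> z *\<^sub>R g z)"
    using integral_test_function(1)[OF opU tU(1) li(2)] integral_test_function(1)[OF opU tU(2) li(2)]
    by (simp add: sum scaleR_add_left)
  finally show "(LINT z|lebesgue_on ?\<Omega>. ?D \<phi> z *\<^sub>R f z) = - (LINT z|lebesgue_on ?\<Omega>. \<phi> z *\<^sub>R g z)" .
qed

section \<open>Lebesgue and Sobolev spaces\<close>

text \<open>The sum is at most twice the larger term. This crude bound is the origin of the factor
  \<open>2 powr p\<close> in the triangle inequality for the energy.\<close>

lemma powr_add_le:
  fixes a b p :: real
  assumes "0 \<le> a" "0 \<le> b" "0 \<le> p"
  shows "(a + b) powr p \<le> 2 powr p * (a powr p + b powr p)"
proof -
  have "(a + b) powr p \<le> (2 * max a b) powr p"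
    using assms by (intro powr_mono2) auto
  also have "\<dots> = 2 powr p * max a b powr p"
    using assms by (simp add: powr_mult)
  also have "max a b powr p \<le> a powr p + b powr p"
    by (simp add: max_def)
  finally show ?thesis by simp
qed

lemma LpD:
  assumes "f \<in> Lp p \<Omega>"
  shows "f \<in> borel_measurable (lebesgue_on \<Omega>)" "integrable (lebesgue_on \<Omega>) (\<lambda>z. norm (f z) powr p)"
  using assms unfolding Lp_def by blast+

lemma LpI:
  assumes "f \<in> borel_measurable (lebesgue_on \<Omega>)" "integrable (lebesgue_on \<Omega>) (\<lambda>z. norm (f z) powr p)"
  shows "f \<in> Lp p \<Omega>"
  using assms unfolding Lp_def by blast

text \<open>The pointwise bound of \<open>norm (f z)\<close> by
  \<open>1 + norm (f z) powr p\<close>, together with the finite measure of compact sets, takes the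
  place of Hoelder's inequality.\<close>

lemma Lp_locally_integrable:
  fixes f :: "complex \<Rightarrow> 'a::euclidean_space"
  assumes "1 \<le> p" "open \<Omega>" "f \<in> Lp p \<Omega>"
  shows "locally_integrable \<Omega> f"
  unfolding locally_integrable_def
proof (intro allI impI)
  fix K assume K: "compact K \<and> K \<subseteq> \<Omega>"
  then have Km: "K \<in> sets lebesgue" by (simp add: compact_imp_closed)
  interpret finite_measure "lebesgue_on K"
    using K by (intro finite_measure_lebesgue_on lmeasurable_compact) simp
  have "integrable (lebesgue_on \<Omega>) (\<lambda>z. norm (f z) powr p)"
    using assms(3) by (rule LpD)
  then have "integrable (lebesgue_on K) (\<lambda>z. norm (f z) powr p)"
    by (rule integrable_lebesgue_on_subset) (use assms(2) K Km in simp_all)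
  then have "integrable (lebesgue_on K) (\<lambda>z. 1 + norm (f z) powr p)"
    by simp
  then show "integrable (lebesgue_on K) f"
  proof (rule Bochner_Integration.integrable_bound)
    show "f \<in> borel_measurable (lebesgue_on K)"
      using LpD(1)[OF assms(3)] K by (blast intro: measurable_restrict_mono)
    have "norm (f z) \<le> 1 + norm (f z) powr p" for z
    proof (cases "norm (f z) \<le> 1")
      case False
      then have "norm (f z) powr 1 \<le> norm (f z) powr p"
        using assms(1) by (intro powr_mono) auto
      then show ?thesis by simp
    qed (simp add: add_increasing2)
    then show "AE z in lebesgue_on K. norm (f z) \<le> norm (1 + norm (f z) powr p)"
      by (auto intro: AE_I2)
  qed
qed

lemma Lp_AE_cong:
  fixes f :: "complex \<Rightarrow> 'a::euclidean_space"
  assumes "\<Omega> \<in> sets lebesgue" "f \<in> Lp p \<Omega>" "AE z in lebesgue_on \<Omega>. f z = g z"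
  shows "g \<in> Lp p \<Omega>"
proof -
  have "AE z in lebesgue_on \<Omega>. norm (f z) powr p = norm (g z) powr p"
    using assms(3) by eventually_elim simp
  moreover have "integrable (lebesgue_on \<Omega>) (\<lambda>z. norm (f z) powr p)"
    using assms(2) by (rule LpD)
  ultimately have "integrable (lebesgue_on \<Omega>) (\<lambda>z. norm (g z) powr p)"
    using assms(1) integrable_lebesgue_on_AE_cong[of \<Omega> "\<lambda>z. norm (f z) powr p" "\<lambda>z. norm (g z) powr p"]
    by blast
  moreover have "g \<in> borel_measurable (lebesgue_on \<Omega>)"
    using LpD(1)[OF assms(2)] assms(3,1) by (rule borel_measurable_lebesgue_on_AE_cong)
  ultimately show ?thesis by (intro LpI)
qed

lemma Lp_subset:
  fixes f :: "complex \<Rightarrow> 'a::euclidean_space"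
  assumes "f \<in> Lp p \<Omega>" "\<Omega>' \<subseteq> \<Omega>" "\<Omega> \<in> sets lebesgue" "\<Omega>' \<in> sets lebesgue"
  shows "f \<in> Lp p \<Omega>'"
  using measurable_restrict_mono[OF LpD(1)[OF assms(1)] assms(2)]
    integrable_lebesgue_on_subset[OF LpD(2)[OF assms(1)] assms(4,3,2)]
  by (rule LpI)

lemma Lp_diff:
  fixes f g :: "complex \<Rightarrow> 'a::euclidean_space"
  assumes "0 \<le> p" "f \<in> Lp p \<Omega>" "g \<in> Lp p \<Omega>"
  shows "(\<lambda>z. f z - g z) \<in> Lp p \<Omega>"
proof -
  have [measurable]: "f \<in> borel_measurable (lebesgue_on \<Omega>)" "g \<in> borel_measurable (lebesgue_on \<Omega>)"
    using assms(2,3) by (blast intro: LpD)+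
  have "integrable (lebesgue_on \<Omega>) (\<lambda>z. 2 powr p * (norm (f z) powr p + norm (g z) powr p))"
    using LpD(2)[OF assms(2)] LpD(2)[OF assms(3)]
    by (intro integrable_mult_right Bochner_Integration.integrable_add)
  then have "integrable (lebesgue_on \<Omega>) (\<lambda>z. norm (f z - g z) powr p)"
  proof (rule Bochner_Integration.integrable_bound)
    have "norm (f z - g z) powr p \<le> 2 powr p * (norm (f z) powr p + norm (g z) powr p)" for z
      using powr_mono2[OF assms(1) _ norm_triangle_ineq4[of "f z" "g z"]]
        powr_add_le[OF _ _ assms(1), of "norm (f z)" "norm (g z)"] by simp
    then show "AE z in lebesgue_on \<Omega>. norm (norm (f z - g z) powr p)
        \<le> norm (2 powr p * (norm (f z) powr p + norm (g z) powr p))"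
      by (auto intro: AE_I2)
  qed measurable
  then show ?thesis by (intro LpI) measurable
qed

lemma Lp_Un:
  fixes f :: "complex \<Rightarrow> 'a::euclidean_space"
  assumes "\<Omega>\<^sub>1 \<in> sets lebesgue" "\<Omega>\<^sub>2 \<in> sets lebesgue" "f \<in> Lp p \<Omega>\<^sub>1" "f \<in> Lp p \<Omega>\<^sub>2"
  shows "f \<in> Lp p (\<Omega>\<^sub>1 \<union> \<Omega>\<^sub>2)"
proof -
  have m: "\<Omega>\<^sub>1 \<inter> space lebesgue \<in> sets lebesgue" "\<Omega>\<^sub>2 \<inter> space lebesgue \<in> sets lebesgue"
    "(\<Omega>\<^sub>1 \<union> \<Omega>\<^sub>2) \<inter> space lebesgue \<in> sets lebesgue"
    using assms(1,2) by auto
  \<comment> \<open>The union is cut into the disjoint pieces \<open>\<Omega>\<^sub>1\<close> and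
    \<open>\<Omega>\<^sub>2 - \<Omega>\<^sub>1\<close>. The identity is stated for a general
    \<open>h\<close> because it is applied both to \<open>f\<close> and to the power of its
    norm.\<close>
  have split: "(\<lambda>x. indicator (\<Omega>\<^sub>1 \<union> \<Omega>\<^sub>2) x *\<^sub>R h x)
      = (\<lambda>x. indicator \<Omega>\<^sub>1 x *\<^sub>R h x + indicator (- \<Omega>\<^sub>1) x *\<^sub>R indicator \<Omega>\<^sub>2 x *\<^sub>R h x)"
    for h :: "complex \<Rightarrow> 'c::real_vector"
    by (auto simp: indicator_def)
  have [measurable]: "- \<Omega>\<^sub>1 \<in> sets lebesgue"
    using sets.compl_sets[OF assms(1)] by (simp add: Compl_eq_Diff_UNIV)
  have [measurable]: "(\<lambda>x. indicator \<Omega>\<^sub>1 x *\<^sub>R f x) \<in> borel_measurable lebesgue"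
    "(\<lambda>x. indicator \<Omega>\<^sub>2 x *\<^sub>R f x) \<in> borel_measurable lebesgue"
    using LpD(1)[OF assms(3)] LpD(1)[OF assms(4)] m by (simp_all only: borel_measurable_restrict_space_iff)
  have "f \<in> borel_measurable (lebesgue_on (\<Omega>\<^sub>1 \<union> \<Omega>\<^sub>2))"
    by (simp only: borel_measurable_restrict_space_iff[OF m(3)] split) measurable
  moreover have "integrable (lebesgue_on (\<Omega>\<^sub>1 \<union> \<Omega>\<^sub>2)) (\<lambda>z. norm (f z) powr p)"
  proof -
    have 1: "integrable lebesgue (\<lambda>x. indicator \<Omega>\<^sub>1 x *\<^sub>R (norm (f x) powr p))"
      using LpD(2)[OF assms(3)] m by (simp only: integrable_restrict_space)
    have "integrable lebesgue (\<lambda>x. indicator \<Omega>\<^sub>2 x *\<^sub>R (norm (f x) powr p))"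
      using LpD(2)[OF assms(4)] m by (simp only: integrable_restrict_space)
    then have "integrable lebesgue (\<lambda>x. indicator (- \<Omega>\<^sub>1) x *\<^sub>R indicator \<Omega>\<^sub>2 x *\<^sub>R (norm (f x) powr p))"
      by (rule integrable_mult_indicator[rotated]) fact
    with 1 show ?thesis
      by (simp only: integrable_restrict_space[OF m(3)] split Bochner_Integration.integrable_add)
  qed
  ultimately show ?thesis by (rule LpI)
qed

section \<open>The chosen weak derivative\<close>

lemma has_weak_deriv_weak_deriv:
  "has_weak_deriv \<Omega> f v g \<Longrightarrow> has_weak_deriv \<Omega> f v (weak_deriv \<Omega> f v)"
  unfolding weak_deriv_def by (rule someI[of "has_weak_deriv \<Omega> f v"])

lemma AE_weak_deriv_eq:
  fixes f :: "complex \<Rightarrow> 'a::euclidean_space"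
  assumes "open \<Omega>" "has_weak_deriv \<Omega> f v g"
  shows "AE z in lebesgue_on \<Omega>. weak_deriv \<Omega> f v z = g z"
  using has_weak_deriv_unique[OF assms(1) has_weak_deriv_weak_deriv[OF assms(2)] assms(2)] .

text \<open>Here equality holds as functions, not just almost everywhere: both maps have the same
  set of weak derivatives, and the choice operator depends on that set alone.\<close>

lemma weak_deriv_AE_cong:
  fixes f g :: "complex \<Rightarrow> 'a::euclidean_space"
  assumes "open \<Omega>" "AE z in lebesgue_on \<Omega>. f z = g z"
  shows "weak_deriv \<Omega> f v = weak_deriv \<Omega> g v"
proof -
  have *: "AE z in lebesgue_on \<Omega>. g z = f z"
    using assms(2) by eventually_elim simp
  have "has_weak_deriv \<Omega> f v = has_weak_deriv \<Omega> g v"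
  proof
    fix h :: "complex \<Rightarrow> 'a"
    have r: "AE z in lebesgue_on \<Omega>. h z = h z" by simp
    show "has_weak_deriv \<Omega> f v h = has_weak_deriv \<Omega> g v h"
      using has_weak_deriv_AE_cong[OF assms(1) _ assms(2) r] has_weak_deriv_AE_cong[OF assms(1) _ * r]
      by blast
  qed
  then show ?thesis by (simp add: weak_deriv_def)
qed

text \<open>Membership in \<open>sobolev\<close> promises some weak derivative in \<open>Lp\<close>;
  by uniqueness the chosen one agrees with it almost everywhere and so lies in \<open>Lp\<close>
  too.\<close>

lemma sobolevD:
  fixes f :: "complex \<Rightarrow> 'a::euclidean_space"
  assumes "open \<Omega>" "f \<in> sobolev p \<Omega>" "v \<in> {1, \<i>}"
  shows "has_weak_deriv \<Omega> f v (weak_deriv \<Omega> f v)" "weak_deriv \<Omega> f v \<in> Lp p \<Omega>" "f \<in> Lp p \<Omega>"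
proof -
  show "f \<in> Lp p \<Omega>" using assms(2) unfolding sobolev_def by blast
  obtain g where g: "g \<in> Lp p \<Omega>" "has_weak_deriv \<Omega> f v g"
    using assms(2,3) unfolding sobolev_def by blast
  show "has_weak_deriv \<Omega> f v (weak_deriv \<Omega> f v)"
    using g(2) by (rule has_weak_deriv_weak_deriv)
  have "AE z in lebesgue_on \<Omega>. g z = weak_deriv \<Omega> f v z"
    using AE_weak_deriv_eq[OF assms(1) g(2)] by eventually_elim simp
  then show "weak_deriv \<Omega> f v \<in> Lp p \<Omega>"
    using Lp_AE_cong[OF _ g(1)] assms(1) by simp
qed

lemma sobolevI:
  assumes "f \<in> Lp p \<Omega>" "\<And>v. v \<in> {1, \<i>} \<Longrightarrow> g v \<in> Lp p \<Omega>"
    "\<And>v. v \<in> {1, \<i>} \<Longrightarrow> has_weak_deriv \<Omega> f v (g v)"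
  shows "f \<in> sobolev p \<Omega>"
  using assms unfolding sobolev_def by blast

lemma
  fixes f :: "complex \<Rightarrow> 'a::euclidean_space"
  assumes op: "open \<Omega>" "open \<Omega>'" and sub: "\<Omega>' \<subseteq> \<Omega>" and f: "f \<in> sobolev p \<Omega>"
  shows sobolev_subset: "f \<in> sobolev p \<Omega>'"
    and AE_weak_deriv_subset:
      "v \<in> {1, \<i>} \<Longrightarrow> AE z in lebesgue_on \<Omega>'. weak_deriv \<Omega>' f v z = weak_deriv \<Omega> f v z"
proof -
  have m: "\<Omega> \<in> sets lebesgue" "\<Omega>' \<in> sets lebesgue" using op by simp_all
  have wd: "has_weak_deriv \<Omega>' f v (weak_deriv \<Omega> f v)" if "v \<in> {1, \<i>}" for v
    using has_weak_deriv_subset[OF op sub sobolevD(1)[OF op(1) f that]] .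
  show "f \<in> sobolev p \<Omega>'"
    by (rule sobolevI[OF Lp_subset[OF sobolevD(3)[OF op(1) f] sub m]
      Lp_subset[OF sobolevD(2)[OF op(1) f] sub m] wd]) auto
  show "v \<in> {1, \<i>} \<Longrightarrow> AE z in lebesgue_on \<Omega>'. weak_deriv \<Omega>' f v z = weak_deriv \<Omega> f v z"
    using AE_weak_deriv_eq[OF op(2) wd] .
qed

lemma
  fixes f g :: "complex \<Rightarrow> 'a::euclidean_space"
  assumes p: "0 \<le> p" and op: "open \<Omega>" and fg: "f \<in> sobolev p \<Omega>" "g \<in> sobolev p \<Omega>"
  shows sobolev_diff: "(\<lambda>z. f z - g z) \<in> sobolev p \<Omega>"
    and AE_weak_deriv_diff: "v \<in> {1, \<i>} \<Longrightarrow> AE z in lebesgue_on \<Omega>.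
      weak_deriv \<Omega> (\<lambda>z. f z - g z) v z = weak_deriv \<Omega> f v z - weak_deriv \<Omega> g v z"
proof -
  have wd: "has_weak_deriv \<Omega> (\<lambda>z. f z - g z) v (\<lambda>z. weak_deriv \<Omega> f v z - weak_deriv \<Omega> g v z)"
    if "v \<in> {1, \<i>}" for v
    using has_weak_deriv_diff[OF op sobolevD(1)[OF op fg(1) that] sobolevD(1)[OF op fg(2) that]] .
  show "(\<lambda>z. f z - g z) \<in> sobolev p \<Omega>"
    by (rule sobolevI[OF Lp_diff[OF p sobolevD(3)[OF op fg(1)] sobolevD(3)[OF op fg(2)]]
      Lp_diff[OF p sobolevD(2)[OF op fg(1)] sobolevD(2)[OF op fg(2)]] wd]) auto
  show "v \<in> {1, \<i>} \<Longrightarrow> AE z in lebesgue_on \<Omega>.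
      weak_deriv \<Omega> (\<lambda>z. f z - g z) v z = weak_deriv \<Omega> f v z - weak_deriv \<Omega> g v z"
    using AE_weak_deriv_eq[OF op wd] .
qed

section \<open>The Sobolev energy\<close>

text \<open>The \<open>p\<close>-th power of the Sobolev norm satisfies a triangle inequality up to the factor
  \<open>2\<^sup>p\<close>, which suffices here and avoids Minkowski's inequality.\<close>

definition energy_density :: "real \<Rightarrow> complex set \<Rightarrow> (complex \<Rightarrow> 'a::euclidean_space) \<Rightarrow> complex \<Rightarrow> real" where
  "energy_density p \<Omega> f z =
     norm (f z) powr p + norm (weak_deriv \<Omega> f 1 z) powr p + norm (weak_deriv \<Omega> f \<i> z) powr p"

definition energy :: "real \<Rightarrow> complex set \<Rightarrow> (complex \<Rightarrow> 'a::euclidean_space) \<Rightarrow> real" where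
  "energy p \<Omega> f = (LINT z|lebesgue_on \<Omega>. energy_density p \<Omega> f z)"

lemma energy_density_nonneg [simp]: "0 \<le> energy_density p \<Omega> f z"
  by (simp add: energy_density_def)

lemma energy_nonneg [simp]: "0 \<le> energy p \<Omega> f"
  by (simp add: energy_def)

lemma integrable_energy_density:
  fixes f :: "complex \<Rightarrow> 'a::euclidean_space"
  assumes "open \<Omega>" "f \<in> sobolev p \<Omega>"
  shows "integrable (lebesgue_on \<Omega>) (energy_density p \<Omega> f)"
  unfolding energy_density_def[abs_def]
  using LpD(2)[OF sobolevD(3)[OF assms, of 1]] LpD(2)[OF sobolevD(2)[OF assms, of 1]]
    LpD(2)[OF sobolevD(2)[OF assms, of \<i>]]
  by (intro Bochner_Integration.integrable_add) auto

lemma sobolev_norm_eq_energy: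
  fixes f :: "complex \<Rightarrow> 'a::euclidean_space"
  assumes "open \<Omega>" "f \<in> sobolev p \<Omega>"
  shows "sobolev_norm p \<Omega> f = energy p \<Omega> f powr (1 / p)"
proof -
  have i: "integrable (lebesgue_on \<Omega>) (\<lambda>z. norm (f z) powr p)"
    "integrable (lebesgue_on \<Omega>) (\<lambda>z. norm (weak_deriv \<Omega> f 1 z) powr p)"
    "integrable (lebesgue_on \<Omega>) (\<lambda>z. norm (weak_deriv \<Omega> f \<i> z) powr p)"
    using LpD(2)[OF sobolevD(3)[OF assms, of 1]] LpD(2)[OF sobolevD(2)[OF assms, of 1]]
      LpD(2)[OF sobolevD(2)[OF assms, of \<i>]] by auto
  have "energy p \<Omega> f = (LINT z|lebesgue_on \<Omega>. norm (f z) powr p)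
      + (LINT z|lebesgue_on \<Omega>. norm (weak_deriv \<Omega> f 1 z) powr p)
      + (LINT z|lebesgue_on \<Omega>. norm (weak_deriv \<Omega> f \<i> z) powr p)"
    unfolding energy_def energy_density_def using i by simp
  then show ?thesis by (simp add: sobolev_norm_def)
qed

text \<open>Replacing a radius \<open>e\<close> by \<open>e powr p\<close> translates every norm
  condition into one on the energy, where the estimates are carried out.\<close>

lemma sobolev_norm_less_iff:
  fixes f :: "complex \<Rightarrow> 'a::euclidean_space"
  assumes "0 < p" "open \<Omega>" "f \<in> sobolev p \<Omega>" "0 < e"
  shows "sobolev_norm p \<Omega> f < e \<longleftrightarrow> energy p \<Omega> f < e powr p"
proof -
  have "e = (e powr p) powr (1 / p)"
    using assms by (simp add: powr_powr)
  then have "sobolev_norm p \<Omega> f < e \<longleftrightarrow> energy p \<Omega> f powr (1 / p) < (e powr p) powr (1 / p)"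
    using sobolev_norm_eq_energy[OF assms(2,3)] by simp
  also have "\<dots> \<longleftrightarrow> energy p \<Omega> f < e powr p"
    using assms(1) by (meson energy_nonneg linorder_not_le powr_ge_zero powr_less_mono2 powr_mono2
        divide_pos_pos zero_less_one less_imp_le)
  finally show ?thesis .
qed

lemma sobolev_AE_cong:
  fixes f g :: "complex \<Rightarrow> 'a::euclidean_space"
  assumes "open \<Omega>" "f \<in> sobolev p \<Omega>" "AE z in lebesgue_on \<Omega>. f z = g z"
  shows "g \<in> sobolev p \<Omega>"
proof (rule sobolevI)
  show "g \<in> Lp p \<Omega>"
    using Lp_AE_cong[OF _ sobolevD(3)[OF assms(1,2), of 1] assms(3)] assms(1) by simp
  show "weak_deriv \<Omega> f v \<in> Lp p \<Omega>" if "v \<in> {1, \<i>}" for v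
    using sobolevD(2)[OF assms(1,2) that] .
  show "has_weak_deriv \<Omega> g v (weak_deriv \<Omega> f v)" if "v \<in> {1, \<i>}" for v
    by (rule has_weak_deriv_AE_cong[OF assms(1) sobolevD(1)[OF assms(1,2) that] assms(3)]) simp
qed

lemma energy_AE_cong:
  fixes f g :: "complex \<Rightarrow> 'a::euclidean_space"
  assumes "open \<Omega>" "f \<in> sobolev p \<Omega>" "AE z in lebesgue_on \<Omega>. f z = g z"
  shows "energy p \<Omega> f = energy p \<Omega> g"
  unfolding energy_def
proof (rule integral_cong_AE)
  show "energy_density p \<Omega> f \<in> borel_measurable (lebesgue_on \<Omega>)"
    "energy_density p \<Omega> g \<in> borel_measurable (lebesgue_on \<Omega>)"
    using integrable_energy_density[OF assms(1,2)]
      integrable_energy_density[OF assms(1) sobolev_AE_cong[OF assms]] by simp_all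
  show "AE z in lebesgue_on \<Omega>. energy_density p \<Omega> f z = energy_density p \<Omega> g z"
    using assms(3) unfolding energy_density_def weak_deriv_AE_cong[OF assms(1,3)]
    by eventually_elim simp
qed

text \<open>Because \<open>weak_deriv\<close> is linear only up to null sets, this almost everywhere
  formula is what stands in for linearity in every pointwise estimate of a difference.\<close>

lemma AE_energy_density_diff:
  fixes f g :: "complex \<Rightarrow> 'a::euclidean_space"
  assumes "0 \<le> p" "open \<Omega>" "f \<in> sobolev p \<Omega>" "g \<in> sobolev p \<Omega>"
  shows "AE z in lebesgue_on \<Omega>. energy_density p \<Omega> (\<lambda>z. f z - g z) z =
    norm (f z - g z) powr p + norm (weak_deriv \<Omega> f 1 z - weak_deriv \<Omega> g 1 z) powr p
    + norm (weak_deriv \<Omega> f \<i> z - weak_deriv \<Omega> g \<i> z) powr p"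
proof -
  have "AE z in lebesgue_on \<Omega>. weak_deriv \<Omega> (\<lambda>z. f z - g z) 1 z = weak_deriv \<Omega> f 1 z - weak_deriv \<Omega> g 1 z"
    "AE z in lebesgue_on \<Omega>. weak_deriv \<Omega> (\<lambda>z. f z - g z) \<i> z = weak_deriv \<Omega> f \<i> z - weak_deriv \<Omega> g \<i> z"
    by (rule AE_weak_deriv_diff[OF assms], simp)+
  then show ?thesis
    by eventually_elim (simp add: energy_density_def)
qed

lemma energy_diff_commute:
  fixes f g :: "complex \<Rightarrow> 'a::euclidean_space"
  assumes "0 \<le> p" "open \<Omega>" "f \<in> sobolev p \<Omega>" "g \<in> sobolev p \<Omega>"
  shows "energy p \<Omega> (\<lambda>z. f z - g z) = energy p \<Omega> (\<lambda>z. g z - f z)"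
  unfolding energy_def
proof (rule integral_cong_AE)
  show "energy_density p \<Omega> (\<lambda>z. f z - g z) \<in> borel_measurable (lebesgue_on \<Omega>)"
    "energy_density p \<Omega> (\<lambda>z. g z - f z) \<in> borel_measurable (lebesgue_on \<Omega>)"
    using integrable_energy_density[OF assms(2) sobolev_diff[OF assms]]
      integrable_energy_density[OF assms(2) sobolev_diff[OF assms(1,2,4,3)]] by simp_all
  show "AE z in lebesgue_on \<Omega>. energy_density p \<Omega> (\<lambda>z. f z - g z) z = energy_density p \<Omega> (\<lambda>z. g z - f z) z"
    using AE_energy_density_diff[OF assms] AE_energy_density_diff[OF assms(1,2,4,3)]
    by eventually_elim (simp add: norm_minus_commute)
qed

lemma energy_diff_self:
  fixes f :: "complex \<Rightarrow> 'a::euclidean_space"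
  assumes "0 < p" "open \<Omega>" "f \<in> sobolev p \<Omega>"
  shows "energy p \<Omega> (\<lambda>z. f z - f z) = 0"
proof -
  have "AE z in lebesgue_on \<Omega>. energy_density p \<Omega> (\<lambda>z. f z - f z) z = 0"
    using AE_energy_density_diff[OF less_imp_le[OF assms(1)] assms(2,3,3)]
    by eventually_elim (use assms(1) in simp)
  then show ?thesis
    unfolding energy_def by (rule integral_eq_zero_AE)
qed

lemma energy_triangle:
  fixes f g h :: "complex \<Rightarrow> 'a::euclidean_space"
  assumes "0 \<le> p" "open \<Omega>" and s: "f \<in> sobolev p \<Omega>" "g \<in> sobolev p \<Omega>" "h \<in> sobolev p \<Omega>"
  shows "energy p \<Omega> (\<lambda>z. f z - h z)
    \<le> 2 powr p * (energy p \<Omega> (\<lambda>z. f z - g z) + energy p \<Omega> (\<lambda>z. g z - h z))"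
proof -
  have i: "integrable (lebesgue_on \<Omega>) (energy_density p \<Omega> (\<lambda>z. f z - h z))"
    "integrable (lebesgue_on \<Omega>) (energy_density p \<Omega> (\<lambda>z. f z - g z))"
    "integrable (lebesgue_on \<Omega>) (energy_density p \<Omega> (\<lambda>z. g z - h z))"
    using assms(1,2) s by (blast intro: integrable_energy_density sobolev_diff)+
  have le: "norm (x - z) powr p \<le> 2 powr p * (norm (x - y) powr p + norm (y - z) powr p)" for x y z :: 'a
    using powr_mono2[OF assms(1) norm_ge_zero norm_triangle_ineq[of "x - y" "y - z"]]
      powr_add_le[OF norm_ge_zero norm_ge_zero assms(1), of "x - y" "y - z"] by simp
  have "AE z in lebesgue_on \<Omega>. energy_density p \<Omega> (\<lambda>z. f z - h z) z
      \<le> 2 powr p * (energy_density p \<Omega> (\<lambda>z. f z - g z) z + energy_density p \<Omega> (\<lambda>z. g z - h z) z)"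
    using AE_energy_density_diff[OF assms(1,2) s(1,3)] AE_energy_density_diff[OF assms(1,2) s(1,2)]
      AE_energy_density_diff[OF assms(1,2) s(2,3)]
  proof eventually_elim
    case (elim z)
    show ?case
      unfolding elim distrib_left
      using le[of "f z" "h z" "g z"] le[of "weak_deriv \<Omega> f 1 z" "weak_deriv \<Omega> h 1 z" "weak_deriv \<Omega> g 1 z"]
        le[of "weak_deriv \<Omega> f \<i> z" "weak_deriv \<Omega> h \<i> z" "weak_deriv \<Omega> g \<i> z"]
      by (simp only: distrib_left)
  qed
  then have "energy p \<Omega> (\<lambda>z. f z - h z) \<le> (LINT z|lebesgue_on \<Omega>.
      2 powr p * (energy_density p \<Omega> (\<lambda>z. f z - g z) z + energy_density p \<Omega> (\<lambda>z. g z - h z) z))"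
    unfolding energy_def using i by (intro integral_mono_AE) auto
  also have "\<dots> = 2 powr p * (energy p \<Omega> (\<lambda>z. f z - g z) + energy p \<Omega> (\<lambda>z. g z - h z))"
    unfolding energy_def using i by simp
  finally show ?thesis .
qed

lemma energy_subset:
  fixes f :: "complex \<Rightarrow> 'a::euclidean_space"
  assumes op: "open \<Omega>" "open \<Omega>'" and sub: "\<Omega>' \<subseteq> \<Omega>" and f: "f \<in> sobolev p \<Omega>"
  shows "energy p \<Omega>' f \<le> energy p \<Omega> f"
proof -
  have m: "\<Omega> \<in> sets lebesgue" "\<Omega>' \<in> sets lebesgue" using op by simp_all
  have i: "integrable (lebesgue_on \<Omega>) (energy_density p \<Omega> f)"
    using op(1) f by (rule integrable_energy_density)
  have i': "integrable (lebesgue_on \<Omega>') (energy_density p \<Omega> f)"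
    using i m(2,1) sub by (rule integrable_lebesgue_on_subset)
  have "AE z in lebesgue_on \<Omega>'. energy_density p \<Omega>' f z = energy_density p \<Omega> f z"
    using AE_weak_deriv_subset[OF op sub f, of 1, simplified] AE_weak_deriv_subset[OF op sub f, of \<i>, simplified]
    by eventually_elim (simp add: energy_density_def)
  then have "energy p \<Omega>' f = (LINT z|lebesgue_on \<Omega>'. energy_density p \<Omega> f z)"
    unfolding energy_def
    using integrable_energy_density[OF op(2) sobolev_subset[OF op sub f]] i'
    by (intro integral_cong_AE) auto
  \<comment> \<open>Written over the whole plane with indicators, the smaller domain merely discards
    part of a nonnegative integrand.\<close>
  also have "\<dots> \<le> energy p \<Omega> f"
    unfolding energy_def
    using i i' m sub
    by (simp only: integral_restrict_space integrable_restrict_space sets.Int_space_eq2)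
      (intro integral_mono; auto simp: indicator_def)
  finally show ?thesis .
qed

section \<open>Open neighbourhoods of small energy\<close>

text \<open>With a factor in the triangle inequality, the usual argument does not show that the
  energy ball \<open>N g r\<close> is open. The neighbourhood is therefore its interior: the points
  around which some energy ball still fits into \<open>N g r\<close>.\<close>

lemma sobolev_small_nbhd:
  fixes g :: "complex \<Rightarrow> 'a::euclidean_space"
  assumes p: "0 < p" and op: "open \<Omega>" and g: "g \<in> sobolev p \<Omega>" and r: "0 < r"
  obtains U where "openin (sobolev_topology p \<Omega>) U" "g \<in> U"
    "\<And>f. f \<in> U \<Longrightarrow> f \<in> sobolev p \<Omega>" "\<And>f. f \<in> U \<Longrightarrow> energy p \<Omega> (\<lambda>z. f z - g z) < r"
proof
  define N :: "(complex \<Rightarrow> 'a) \<Rightarrow> real \<Rightarrow> (complex \<Rightarrow> 'a) set"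
    where "N f s = {h \<in> sobolev p \<Omega>. energy p \<Omega> (\<lambda>z. h z - f z) < s}" for f s
  let ?U = "{f \<in> sobolev p \<Omega>. \<exists>s>0. N f s \<subseteq> N g r}"
  have self: "f \<in> N f s" if "f \<in> sobolev p \<Omega>" "s > 0" for f s
    using that energy_diff_self[OF p op that(1)] by (simp add: N_def)
  show "g \<in> ?U" using g r by blast
  show "f \<in> sobolev p \<Omega>" if "f \<in> ?U" for f using that by blast
  show "energy p \<Omega> (\<lambda>z. f z - g z) < r" if "f \<in> ?U" for f
  proof -
    from that obtain s where s: "s > 0" "N f s \<subseteq> N g r" and f: "f \<in> sobolev p \<Omega>" by blast
    have "f \<in> N g r" using self[OF f s(1)] s(2) by (rule rev_subsetD)
    then show ?thesis by (simp add: N_def)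
  qed
  show "openin (sobolev_topology p \<Omega>) ?U"
    unfolding openin_sobolev_topology
  proof (intro conjI ballI)
    show "?U \<subseteq> sobolev p \<Omega>" by blast
    fix f assume "f \<in> ?U"
    then obtain s where f: "f \<in> sobolev p \<Omega>" and s: "s > 0" "N f s \<subseteq> N g r" by blast
    \<comment> \<open>Two steps of energy below \<open>t\<close> cost at most
      \<open>2 powr p * (t + t)\<close>, which is exactly \<open>s\<close>.\<close>
    define t where "t = s / (2 * 2 powr p)"
    have t: "t > 0" using s by (simp add: t_def)
    define e where "e = t powr (1 / p)"
    have e: "e > 0" "e powr p = t" using t p by (simp_all add: e_def powr_powr)
    have "h \<in> ?U" if h: "h \<in> sobolev p \<Omega>" "sobolev_norm p \<Omega> (\<lambda>z. h z - f z) < e" for h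
    proof -
      have hf: "energy p \<Omega> (\<lambda>z. h z - f z) < t"
        using h(2) sobolev_norm_less_iff[OF p op sobolev_diff[OF less_imp_le[OF p] op h(1) f] e(1)] e(2)
        by simp
      have "N h t \<subseteq> N f s"
      proof
        fix k assume k: "k \<in> N h t"
        then have "energy p \<Omega> (\<lambda>z. k z - h z) + energy p \<Omega> (\<lambda>z. h z - f z) < 2 * t"
          using hf by (simp add: N_def)
        then have "2 powr p * (energy p \<Omega> (\<lambda>z. k z - h z) + energy p \<Omega> (\<lambda>z. h z - f z)) < 2 powr p * (2 * t)"
          by (intro mult_strict_left_mono) auto
        moreover have "2 powr p * (2 * t) = s" by (simp add: t_def)
        moreover have "k \<in> sobolev p \<Omega>" using k by (simp add: N_def)
        ultimately show "k \<in> N f s"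
          using energy_triangle[OF less_imp_le[OF p] op _ h(1) f, of k] by (simp add: N_def)
      qed
      with s(2) t h(1) show ?thesis by blast
    qed
    with e(1) show "\<exists>e>0. \<forall>h\<in>sobolev p \<Omega>. sobolev_norm p \<Omega> (\<lambda>z. h z - f z) < e \<longrightarrow> h \<in> ?U"
      by blast
  qed
qed

section \<open>J-holomorphic maps\<close>

lemma tendsto_matrix_vector_mult:
  fixes A :: "'b \<Rightarrow> real ^ 'n ^ 'm" and x :: "'b \<Rightarrow> real ^ 'n"
  assumes "(A \<longlongrightarrow> a) F" "(x \<longlongrightarrow> b) F"
  shows "((\<lambda>t. A t *v x t) \<longlongrightarrow> a *v b) F"
  unfolding matrix_vector_mult_def
  by (intro vec_tendstoI) (auto intro!: tendsto_intros tendsto_vec_nth assms)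

lemma tendsto_of_norm_powr:
  fixes x :: "nat \<Rightarrow> 'a::real_normed_vector"
  assumes "0 < p" "u \<longlonglongrightarrow> 0" "\<And>n. norm (x n - a) powr p \<le> u n"
  shows "x \<longlonglongrightarrow> a"
proof -
  have "(\<lambda>n. norm (x n - a) powr p) \<longlonglongrightarrow> 0"
    by (rule tendsto_sandwich[OF _ _ tendsto_const assms(2)]) (use assms(3) in auto)
  then have "(\<lambda>n. (norm (x n - a) powr p) powr (1 / p)) \<longlonglongrightarrow> 0"
    by (rule tendsto_zero_powrI[OF _ tendsto_const]) (use assms(1) in auto)
  then have "(\<lambda>n. norm (x n - a)) \<longlonglongrightarrow> 0"
    using assms(1) by (simp add: powr_powr)
  then show ?thesis
    using LIM_zero_cancel tendsto_norm_zero_iff by blast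
qed

text \<open>The energy density of the difference dominates the p-th powers for the values and for
  both derivatives. Its convergence to 0 in the mean thus gives a single subsequence along which all
  three converge almost everywhere, and continuity of \<open>J\<close> passes the pointwise equation
  to the limit.\<close>

lemma J_holomorphic_limit:
  fixes J :: "real ^ ('n::finite + 'n) \<Rightarrow> real ^ ('n + 'n) ^ ('n + 'n)"
  assumes p: "0 < p" and op: "open \<Omega>" and J: "continuous_on UNIV J"
    and f: "\<And>n. f n \<in> J_holomorphic J p \<Omega>" and g: "g \<in> sobolev p \<Omega>"
    and lim: "(\<lambda>n. energy p \<Omega> (\<lambda>z. f n z - g z)) \<longlonglongrightarrow> 0"
  shows "g \<in> J_holomorphic J p \<Omega>"
proof -
  have fs: "f n \<in> sobolev p \<Omega>" for n using f[of n] by (simp add: J_holomorphic_def)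
  define u where "u n = energy_density p \<Omega> (\<lambda>z. f n z - g z)" for n
  have "\<exists>r::nat\<Rightarrow>nat. strict_mono r \<and> (AE z in lebesgue_on \<Omega>. (\<lambda>n. u (r n) z) \<longlonglongrightarrow> 0)"
  proof (rule tendsto_L1_AE_subseq)
    show "integrable (lebesgue_on \<Omega>) (u n)" for n
      unfolding u_def using integrable_energy_density[OF op sobolev_diff[OF less_imp_le[OF p] op fs g]] .
    show "(\<lambda>n. LINT z|lebesgue_on \<Omega>. norm (u n z)) \<longlonglongrightarrow> 0"
      using lim by (simp add: u_def energy_def)
  qed
  then obtain r :: "nat \<Rightarrow> nat" where r: "AE z in lebesgue_on \<Omega>. (\<lambda>n. u (r n) z) \<longlonglongrightarrow> 0"
    by blast
  \<comment> \<open>Each \<open>n\<close> has its own exceptional null set; there are countably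
    many, so one null set serves all \<open>n\<close>.\<close>
  have dens: "AE z in lebesgue_on \<Omega>. \<forall>n. u n z =
      norm (f n z - g z) powr p + norm (weak_deriv \<Omega> (f n) 1 z - weak_deriv \<Omega> g 1 z) powr p
      + norm (weak_deriv \<Omega> (f n) \<i> z - weak_deriv \<Omega> g \<i> z) powr p"
    unfolding AE_all_countable u_def
    using AE_energy_density_diff[OF less_imp_le[OF p] op fs g] by blast
  have hol: "AE z in lebesgue_on \<Omega>. \<forall>n. \<forall>h.
      weak_differential \<Omega> (f n) z (\<i> * h) = J (f n z) *v weak_differential \<Omega> (f n) z h"
    unfolding AE_all_countable using f unfolding J_holomorphic_def by blast
  from r dens hol have "AE z in lebesgue_on \<Omega>. \<forall>h.
      weak_differential \<Omega> g z (\<i> * h) = J (g z) *v weak_differential \<Omega> g z h"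
  proof eventually_elim
    case (elim z)
    have le: "norm (f (r n) z - g z) powr p \<le> u (r n) z"
      "norm (weak_deriv \<Omega> (f (r n)) 1 z - weak_deriv \<Omega> g 1 z) powr p \<le> u (r n) z"
      "norm (weak_deriv \<Omega> (f (r n)) \<i> z - weak_deriv \<Omega> g \<i> z) powr p \<le> u (r n) z" for n
      using elim(2) by simp_all
    note lims = tendsto_of_norm_powr[OF p elim(1) le(1)] tendsto_of_norm_powr[OF p elim(1) le(2)]
      tendsto_of_norm_powr[OF p elim(1) le(3)]
    have D: "(\<lambda>n. weak_differential \<Omega> (f (r n)) z h) \<longlonglongrightarrow> weak_differential \<Omega> g z h" for h
      unfolding weak_differential_def using lims by (intro tendsto_intros)
    have "(\<lambda>n. J (f (r n) z)) \<longlonglongrightarrow> J (g z)"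
      using continuous_on_tendsto_compose[OF J lims(1)] by simp
    then have "(\<lambda>n. J (f (r n) z) *v weak_differential \<Omega> (f (r n)) z h)
        \<longlonglongrightarrow> J (g z) *v weak_differential \<Omega> g z h" for h
      using D by (rule tendsto_matrix_vector_mult)
    then have "(\<lambda>n. weak_differential \<Omega> (f (r n)) z (\<i> * h))
        \<longlonglongrightarrow> J (g z) *v weak_differential \<Omega> g z h" for h
      using elim(3) by simp
    with D show ?case
      by (blast intro: LIMSEQ_unique)
  qed
  with g show ?thesis by (simp add: J_holomorphic_def)
qed

lemma J_holomorphic_AE_cong:
  assumes op: "open \<Omega>" and f: "f \<in> J_holomorphic J p \<Omega>" and eq: "AE z in lebesgue_on \<Omega>. f z = g z"
  shows "g \<in> J_holomorphic J p \<Omega>"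
proof -
  have fs: "f \<in> sobolev p \<Omega>" using f by (simp add: J_holomorphic_def)
  have "AE z in lebesgue_on \<Omega>. \<forall>h.
      weak_differential \<Omega> f z (\<i> * h) = J (f z) *v weak_differential \<Omega> f z h"
    using f by (simp add: J_holomorphic_def)
  then have "AE z in lebesgue_on \<Omega>. \<forall>h.
      weak_differential \<Omega> g z (\<i> * h) = J (g z) *v weak_differential \<Omega> g z h"
    using eq unfolding weak_differential_def weak_deriv_AE_cong[OF op eq]
    by eventually_elim simp
  with sobolev_AE_cong[OF op fs eq] show ?thesis by (simp add: J_holomorphic_def)
qed

section \<open>Gluing J-holomorphic maps and passing to closures\<close>

lemma J_holomorphic_Un:
  assumes p: "1 \<le> p" and op: "open \<Omega>\<^sub>1" "open \<Omega>\<^sub>2"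
    and f: "f \<in> J_holomorphic J p \<Omega>\<^sub>1" "f \<in> J_holomorphic J p \<Omega>\<^sub>2"
  shows "f \<in> J_holomorphic J p (\<Omega>\<^sub>1 \<union> \<Omega>\<^sub>2)"
proof -
  let ?\<Omega> = "\<Omega>\<^sub>1 \<union> \<Omega>\<^sub>2"
  have m: "\<Omega>\<^sub>1 \<in> sets lebesgue" "\<Omega>\<^sub>2 \<in> sets lebesgue" using op by simp_all
  have opU: "open ?\<Omega>" using op by (rule open_Un)
  have opI: "open (\<Omega>\<^sub>1 \<inter> \<Omega>\<^sub>2)" using op by (rule open_Int)
  have fs: "f \<in> sobolev p \<Omega>\<^sub>1" "f \<in> sobolev p \<Omega>\<^sub>2"
    using f by (simp_all add: J_holomorphic_def)
  \<comment> \<open>On the overlap both local derivatives agree almost everywhere, so preferring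
    \<open>\<Omega>\<^sub>1\<close> there changes nothing up to a null set.\<close>
  define g where "g v z = (if z \<in> \<Omega>\<^sub>1 then weak_deriv \<Omega>\<^sub>1 f v z else weak_deriv \<Omega>\<^sub>2 f v z)" for v z
  have g1: "AE z in lebesgue_on \<Omega>\<^sub>1. weak_deriv \<Omega>\<^sub>1 f v z = g v z" for v
    using m by (intro AE_I2) (simp add: g_def)
  have g2: "AE z in lebesgue_on \<Omega>\<^sub>2. weak_deriv \<Omega>\<^sub>2 f v z = g v z" if v: "v \<in> {1, \<i>}" for v
  proof -
    have "AE z in lebesgue_on (\<Omega>\<^sub>1 \<inter> \<Omega>\<^sub>2). weak_deriv \<Omega>\<^sub>1 f v z = weak_deriv \<Omega>\<^sub>2 f v z"
      using AE_weak_deriv_subset[OF op(1) opI _ fs(1) v] AE_weak_deriv_subset[OF op(2) opI _ fs(2) v]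
      by (auto elim!: eventually_elim2)
    then have "AE z in lebesgue. z \<in> \<Omega>\<^sub>1 \<inter> \<Omega>\<^sub>2 \<longrightarrow> weak_deriv \<Omega>\<^sub>1 f v z = weak_deriv \<Omega>\<^sub>2 f v z"
      using opI by (simp add: AE_restrict_space_iff)
    then have "AE z in lebesgue. z \<in> \<Omega>\<^sub>2 \<longrightarrow> weak_deriv \<Omega>\<^sub>2 f v z = g v z"
      by eventually_elim (simp add: g_def)
    then show ?thesis using m by (simp add: AE_restrict_space_iff)
  qed
  have fL: "f \<in> Lp p ?\<Omega>"
    using Lp_Un[OF m sobolevD(3)[OF op(1) fs(1), of 1] sobolevD(3)[OF op(2) fs(2), of 1]] by simp
  have gL: "g v \<in> Lp p ?\<Omega>" if v: "v \<in> {1, \<i>}" for v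
    using Lp_Un[OF m Lp_AE_cong[OF m(1) sobolevD(2)[OF op(1) fs(1) v] g1]
        Lp_AE_cong[OF m(2) sobolevD(2)[OF op(2) fs(2) v] g2[OF v]]] .
  have wd: "has_weak_deriv ?\<Omega> f v (g v)" if v: "v \<in> {1, \<i>}" for v
  proof (rule has_weak_deriv_Un[OF op])
    show "has_weak_deriv \<Omega>\<^sub>1 f v (g v)"
      by (rule has_weak_deriv_AE_cong[OF op(1) sobolevD(1)[OF op(1) fs(1) v] _ g1]) simp
    show "has_weak_deriv \<Omega>\<^sub>2 f v (g v)"
      by (rule has_weak_deriv_AE_cong[OF op(2) sobolevD(1)[OF op(2) fs(2) v] _ g2[OF v]]) simp
    show "locally_integrable ?\<Omega> f" "locally_integrable ?\<Omega> (g v)"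
      using Lp_locally_integrable[OF p opU] fL gL[OF v] by blast+
  qed
  have fU: "f \<in> sobolev p ?\<Omega>"
    using fL gL wd by (rule sobolevI)
  \<comment> \<open>The equation has to be restated for the differential taken on the union, which
    on each piece agrees almost everywhere with the local one.\<close>
  have hol: "AE z in lebesgue_on \<Omega>. \<forall>h.
      weak_differential ?\<Omega> f z (\<i> * h) = J (f z) *v weak_differential ?\<Omega> f z h"
    if "open \<Omega>" "\<Omega> \<subseteq> ?\<Omega>" "f \<in> J_holomorphic J p \<Omega>" for \<Omega>
  proof -
    have "AE z in lebesgue_on \<Omega>. \<forall>h.
        weak_differential \<Omega> f z (\<i> * h) = J (f z) *v weak_differential \<Omega> f z h"
      using that(3) by (simp add: J_holomorphic_def)
    then show ?thesis
      using AE_weak_deriv_subset[OF opU that(1,2) fU, of 1, simplified]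
        AE_weak_deriv_subset[OF opU that(1,2) fU, of \<i>, simplified]
      by eventually_elim (simp add: weak_differential_def)
  qed
  have "AE z in lebesgue_on ?\<Omega>. \<forall>h.
      weak_differential ?\<Omega> f z (\<i> * h) = J (f z) *v weak_differential ?\<Omega> f z h"
    using hol[OF op(1) _ f(1)] hol[OF op(2) _ f(2)] m by (intro AE_lebesgue_on_Un) auto
  with fU show ?thesis by (simp add: J_holomorphic_def)
qed

lemma J_holomorphic_glue:
  assumes p: "1 \<le> p" and op: "open \<Omega>\<^sub>1" "open \<Omega>\<^sub>2"
    and f: "f\<^sub>1 \<in> J_holomorphic J p \<Omega>\<^sub>1" "f\<^sub>2 \<in> J_holomorphic J p \<Omega>\<^sub>2"
    and eq: "AE z in lebesgue_on (\<Omega>\<^sub>1 \<inter> \<Omega>\<^sub>2). f\<^sub>1 z = f\<^sub>2 z"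
  obtains f where "f \<in> J_holomorphic J p (\<Omega>\<^sub>1 \<union> \<Omega>\<^sub>2)"
    "AE z in lebesgue_on \<Omega>\<^sub>1. f\<^sub>1 z = f z" "AE z in lebesgue_on \<Omega>\<^sub>2. f\<^sub>2 z = f z"
proof
  define f where "f z = (if z \<in> \<Omega>\<^sub>1 then f\<^sub>1 z else f\<^sub>2 z)" for z
  show e1: "AE z in lebesgue_on \<Omega>\<^sub>1. f\<^sub>1 z = f z"
    using op by (intro AE_I2) (simp add: f_def)
  have "AE z in lebesgue. z \<in> \<Omega>\<^sub>1 \<inter> \<Omega>\<^sub>2 \<longrightarrow> f\<^sub>1 z = f\<^sub>2 z"
    using eq op by (simp add: AE_restrict_space_iff open_Int)
  then have "AE z in lebesgue. z \<in> \<Omega>\<^sub>2 \<longrightarrow> f\<^sub>2 z = f z"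
    by eventually_elim (simp add: f_def)
  then show e2: "AE z in lebesgue_on \<Omega>\<^sub>2. f\<^sub>2 z = f z"
    using op by (simp add: AE_restrict_space_iff)
  show "f \<in> J_holomorphic J p (\<Omega>\<^sub>1 \<union> \<Omega>\<^sub>2)"
    using J_holomorphic_Un[OF p op] J_holomorphic_AE_cong[OF op(1) f(1) e1]
      J_holomorphic_AE_cong[OF op(2) f(2) e2] by blast
qed

text \<open>Neighbourhoods of energy radius \<open>inverse (real (Suc n))\<close> turn a point of
  the topological closure into the limit of a sequence from \<open>W\<close>, to which
  \<open>J_holomorphic_limit\<close> applies.\<close>

lemma J_holomorphic_closure:
  fixes J :: "real ^ ('n::finite + 'n) \<Rightarrow> real ^ ('n + 'n) ^ ('n + 'n)"
  assumes p: "0 < p" and op: "open \<Omega>" and J: "continuous_on UNIV J"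
    and W: "W \<subseteq> J_holomorphic J p \<Omega>"
  shows "sobolev_topology p \<Omega> closure_of W \<subseteq> J_holomorphic J p \<Omega>"
proof
  fix g assume g: "g \<in> sobolev_topology p \<Omega> closure_of W"
  then have gs: "g \<in> sobolev p \<Omega>"
    by (simp add: in_closure_of topspace_sobolev_topology)
  have "\<exists>f. f \<in> W \<and> energy p \<Omega> (\<lambda>z. f z - g z) < inverse (real (Suc n))" for n
  proof -
    obtain U where "openin (sobolev_topology p \<Omega>) U" "g \<in> U"
      and U: "\<And>f. f \<in> U \<Longrightarrow> energy p \<Omega> (\<lambda>z. f z - g z) < inverse (real (Suc n))"
      by (rule sobolev_small_nbhd[OF p op gs, of "inverse (real (Suc n))"]) auto
    then obtain f where "f \<in> W" "f \<in> U"
      using g unfolding in_closure_of by blast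
    with U show ?thesis by blast
  qed
  then obtain f where f: "\<And>n. f n \<in> W" "\<And>n. energy p \<Omega> (\<lambda>z. f n z - g z) < inverse (real (Suc n))"
    by metis
  have "(\<lambda>n. energy p \<Omega> (\<lambda>z. f n z - g z)) \<longlonglongrightarrow> 0"
    by (rule tendsto_sandwich[OF _ _ tendsto_const LIMSEQ_inverse_real_of_nat])
      (use less_imp_le[OF f(2)] in \<open>simp_all add: always_eventually\<close>)
  with W f(1) show "g \<in> J_holomorphic J p \<Omega>"
    by (intro J_holomorphic_limit[OF p op J _ gs]) auto
qed

lemma AE_eq_if_energy_diff_0:
  fixes f g :: "complex \<Rightarrow> 'a::euclidean_space"
  assumes p: "0 < p" and op: "open \<Omega>" and s: "f \<in> sobolev p \<Omega>" "g \<in> sobolev p \<Omega>"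
    and 0: "energy p \<Omega> (\<lambda>z. f z - g z) = 0"
  shows "AE z in lebesgue_on \<Omega>. f z = g z"
proof -
  have "AE z in lebesgue_on \<Omega>. energy_density p \<Omega> (\<lambda>z. f z - g z) z = 0"
    using 0 integrable_energy_density[OF op sobolev_diff[OF less_imp_le[OF p] op s]]
    unfolding energy_def by (subst (asm) integral_nonneg_eq_0_iff_AE) auto
  then show ?thesis
  proof eventually_elim
    case (elim z)
    have "norm (f z - g z) powr p \<le> energy_density p \<Omega> (\<lambda>z. f z - g z) z"
      by (simp add: energy_density_def)
    with elim show ?case by simp
  qed
qed

section \<open>The alternative near one pair and its uniform version\<close>

text \<open>The alternative is decided by the energy \<open>d\<close> of the difference of
  \<open>g\<^sub>1\<close> and \<open>g\<^sub>2\<close> on the overlap. The conclusion is phrased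
  with open sets of the two topologies so that their product can enter a cover of the product
  space.\<close>

lemma gluing_near_pair:
  fixes J :: "real ^ ('n::finite + 'n) \<Rightarrow> real ^ ('n + 'n) ^ ('n + 'n)"
  assumes p: "1 \<le> p" and op: "open \<Omega>\<^sub>1" "open \<Omega>\<^sub>2"
    and g: "g\<^sub>1 \<in> J_holomorphic J p \<Omega>\<^sub>1" "g\<^sub>2 \<in> J_holomorphic J p \<Omega>\<^sub>2"
    and \<epsilon>: "0 < \<epsilon>"
  obtains U\<^sub>1 U\<^sub>2 \<delta> where "openin (sobolev_topology p \<Omega>\<^sub>1) U\<^sub>1" "openin (sobolev_topology p \<Omega>\<^sub>2) U\<^sub>2"
    "g\<^sub>1 \<in> U\<^sub>1" "g\<^sub>2 \<in> U\<^sub>2" "0 < \<delta>"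
    "\<And>f\<^sub>1 f\<^sub>2. f\<^sub>1 \<in> U\<^sub>1 \<Longrightarrow> f\<^sub>2 \<in> U\<^sub>2 \<Longrightarrow> sobolev_norm p (\<Omega>\<^sub>1 \<inter> \<Omega>\<^sub>2) (\<lambda>z. f\<^sub>1 z - f\<^sub>2 z) < \<delta> \<Longrightarrow>
      \<exists>f\<in>J_holomorphic J p (\<Omega>\<^sub>1 \<union> \<Omega>\<^sub>2).
        sobolev_norm p \<Omega>\<^sub>1 (\<lambda>z. f z - f\<^sub>1 z) < \<epsilon> \<and> sobolev_norm p \<Omega>\<^sub>2 (\<lambda>z. f z - f\<^sub>2 z) < \<epsilon>"
proof -
  let ?\<Omega> = "\<Omega>\<^sub>1 \<inter> \<Omega>\<^sub>2"
  have p0: "0 < p" "0 \<le> p" using p by simp_all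
  have opI: "open ?\<Omega>" using op by (rule open_Int)
  have gs: "g\<^sub>1 \<in> sobolev p \<Omega>\<^sub>1" "g\<^sub>2 \<in> sobolev p \<Omega>\<^sub>2"
    using g by (simp_all add: J_holomorphic_def)
  have res: "f \<in> sobolev p ?\<Omega>" if "f \<in> sobolev p \<Omega>\<^sub>1 \<or> f \<in> sobolev p \<Omega>\<^sub>2" for f :: "complex \<Rightarrow> real ^ ('n + 'n)"
    using that sobolev_subset[OF op(1) opI] sobolev_subset[OF op(2) opI] by blast
  have gI: "g\<^sub>1 \<in> sobolev p ?\<Omega>" "g\<^sub>2 \<in> sobolev p ?\<Omega>" using gs res by blast+
  define d where "d = energy p ?\<Omega> (\<lambda>z. g\<^sub>1 z - g\<^sub>2 z)"
  show thesis
  proof (cases "d = 0")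
    case True
    then have "AE z in lebesgue_on ?\<Omega>. g\<^sub>1 z = g\<^sub>2 z"
      unfolding d_def by (rule AE_eq_if_energy_diff_0[OF p0(1) opI gI])
    then obtain f where f: "f \<in> J_holomorphic J p (\<Omega>\<^sub>1 \<union> \<Omega>\<^sub>2)"
      "AE z in lebesgue_on \<Omega>\<^sub>1. g\<^sub>1 z = f z" "AE z in lebesgue_on \<Omega>\<^sub>2. g\<^sub>2 z = f z"
      by (rule J_holomorphic_glue[OF p op g])
    have e: "0 < \<epsilon> powr p" using \<epsilon> by simp
    have close: "sobolev_norm p \<Omega> (\<lambda>z. f z - h z) < \<epsilon>"
      if "open \<Omega>" "k \<in> sobolev p \<Omega>" "AE z in lebesgue_on \<Omega>. k z = f z" "h \<in> sobolev p \<Omega>"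
        "energy p \<Omega> (\<lambda>z. h z - k z) < \<epsilon> powr p" for \<Omega> h k
    proof -
      have kh: "(\<lambda>z. k z - h z) \<in> sobolev p \<Omega>"
        using p0(2) that(1,2,4) by (rule sobolev_diff)
      have eq: "AE z in lebesgue_on \<Omega>. k z - h z = f z - h z"
        using that(3) by eventually_elim simp
      have "energy p \<Omega> (\<lambda>z. f z - h z) < \<epsilon> powr p"
        using that(5) energy_AE_cong[OF that(1) kh eq]
          energy_diff_commute[OF p0(2) that(1,2,4)] by simp
      then show ?thesis
        using sobolev_norm_less_iff[OF p0(1) that(1) sobolev_AE_cong[OF that(1) kh eq] \<epsilon>] by simp
    qed
    obtain U\<^sub>1 where U1: "openin (sobolev_topology p \<Omega>\<^sub>1) U\<^sub>1" "g\<^sub>1 \<in> U\<^sub>1" "\<And>f. f \<in> U\<^sub>1 \<Longrightarrow> f \<in> sobolev p \<Omega>\<^sub>1"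
      "\<And>f. f \<in> U\<^sub>1 \<Longrightarrow> energy p \<Omega>\<^sub>1 (\<lambda>z. f z - g\<^sub>1 z) < \<epsilon> powr p"
      by (rule sobolev_small_nbhd[OF p0(1) op(1) gs(1) e]) (rule that)
    obtain U\<^sub>2 where U2: "openin (sobolev_topology p \<Omega>\<^sub>2) U\<^sub>2" "g\<^sub>2 \<in> U\<^sub>2" "\<And>f. f \<in> U\<^sub>2 \<Longrightarrow> f \<in> sobolev p \<Omega>\<^sub>2"
      "\<And>f. f \<in> U\<^sub>2 \<Longrightarrow> energy p \<Omega>\<^sub>2 (\<lambda>z. f z - g\<^sub>2 z) < \<epsilon> powr p"
      by (rule sobolev_small_nbhd[OF p0(1) op(2) gs(2) e]) (rule that)
    show thesis
    \<comment> \<open>The value 1 for \<open>\<delta>\<close> is arbitrary: the glued map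
      \<open>f\<close> agrees almost everywhere with \<open>g\<^sub>1\<close> and
      \<open>g\<^sub>2\<close>, and every pair from \<open>U\<^sub>1\<close> and
      \<open>U\<^sub>2\<close> is close enough to these.\<close>
    proof (rule that[OF U1(1) U2(1) U1(2) U2(2) zero_less_one])
      fix f\<^sub>1 f\<^sub>2 assume "f\<^sub>1 \<in> U\<^sub>1" "f\<^sub>2 \<in> U\<^sub>2"
      then show "\<exists>f\<in>J_holomorphic J p (\<Omega>\<^sub>1 \<union> \<Omega>\<^sub>2).
          sobolev_norm p \<Omega>\<^sub>1 (\<lambda>z. f z - f\<^sub>1 z) < \<epsilon> \<and> sobolev_norm p \<Omega>\<^sub>2 (\<lambda>z. f z - f\<^sub>2 z) < \<epsilon>"
        using f(1) close[OF op(1) gs(1) f(2) U1(3) U1(4)] close[OF op(2) gs(2) f(3) U2(3) U2(4)] by blast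
    qed
  next
    case False
    then have d: "0 < d" unfolding d_def by (simp add: less_le)
    define C :: real where "C = 2 powr p"
    have C: "1 \<le> C" using p0 by (simp add: C_def ge_one_powr_ge_zero)
    \<comment> \<open>The way from \<open>g\<^sub>1\<close> to \<open>g\<^sub>2\<close> through
      \<open>f\<^sub>1\<close> and \<open>f\<^sub>2\<close> uses the triangle inequality twice and
      costs at most \<open>3 * C\<^sup>2 * r\<close>; the denominator makes this three quarters of
      \<open>d\<close>.\<close>
    define r where "r = d / (4 * C\<^sup>2)"
    have r: "0 < r" using d C by (simp add: r_def)
    \<comment> \<open>The p-th root, so that a Sobolev norm below \<open>\<delta>\<close> means an
      energy below \<open>r\<close>.\<close>
    define \<delta> where "\<delta> = r powr (1 / p)"
    have \<delta>: "0 < \<delta>" "\<delta> powr p = r" using r p0 by (simp_all add: \<delta>_def powr_powr)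
    obtain U\<^sub>1 where U1: "openin (sobolev_topology p \<Omega>\<^sub>1) U\<^sub>1" "g\<^sub>1 \<in> U\<^sub>1" "\<And>f. f \<in> U\<^sub>1 \<Longrightarrow> f \<in> sobolev p \<Omega>\<^sub>1"
      "\<And>f. f \<in> U\<^sub>1 \<Longrightarrow> energy p \<Omega>\<^sub>1 (\<lambda>z. f z - g\<^sub>1 z) < r"
      by (rule sobolev_small_nbhd[OF p0(1) op(1) gs(1) r]) (rule that)
    obtain U\<^sub>2 where U2: "openin (sobolev_topology p \<Omega>\<^sub>2) U\<^sub>2" "g\<^sub>2 \<in> U\<^sub>2" "\<And>f. f \<in> U\<^sub>2 \<Longrightarrow> f \<in> sobolev p \<Omega>\<^sub>2"
      "\<And>f. f \<in> U\<^sub>2 \<Longrightarrow> energy p \<Omega>\<^sub>2 (\<lambda>z. f z - g\<^sub>2 z) < r"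
      by (rule sobolev_small_nbhd[OF p0(1) op(2) gs(2) r]) (rule that)
    show thesis
    proof (rule that[OF U1(1) U2(1) U1(2) U2(2) \<delta>(1)])
      fix f\<^sub>1 f\<^sub>2 assume fU: "f\<^sub>1 \<in> U\<^sub>1" "f\<^sub>2 \<in> U\<^sub>2"
        and small: "sobolev_norm p ?\<Omega> (\<lambda>z. f\<^sub>1 z - f\<^sub>2 z) < \<delta>"
      let ?E = "\<lambda>f g. energy p ?\<Omega> (\<lambda>z. f z - g z)"
      have fs: "f\<^sub>1 \<in> sobolev p \<Omega>\<^sub>1" "f\<^sub>2 \<in> sobolev p \<Omega>\<^sub>2" using fU U1(3) U2(3) by blast+
      have fI: "f\<^sub>1 \<in> sobolev p ?\<Omega>" "f\<^sub>2 \<in> sobolev p ?\<Omega>" using fs res by blast+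
      have e12: "?E f\<^sub>1 f\<^sub>2 < r"
        using small sobolev_norm_less_iff[OF p0(1) opI sobolev_diff[OF p0(2) opI fI] \<delta>(1)] \<delta>(2) by simp
      have "?E f\<^sub>1 g\<^sub>1 < r"
        using energy_subset[OF op(1) opI _ sobolev_diff[OF p0(2) op(1) fs(1) gs(1)]] U1(4)[OF fU(1)]
        by simp
      then have e1: "?E g\<^sub>1 f\<^sub>1 < r"
        using energy_diff_commute[OF p0(2) opI fI(1) gI(1)] by simp
      have e2: "?E f\<^sub>2 g\<^sub>2 < r"
        using energy_subset[OF op(2) opI _ sobolev_diff[OF p0(2) op(2) fs(2) gs(2)]] U2(4)[OF fU(2)]
        by simp
      have "?E f\<^sub>1 g\<^sub>2 \<le> C * (?E f\<^sub>1 f\<^sub>2 + ?E f\<^sub>2 g\<^sub>2)"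
        unfolding C_def by (rule energy_triangle[OF p0(2) opI fI gI(2)])
      also have "\<dots> \<le> C * (r + r)"
        using C e12 e2 by (intro mult_left_mono) auto
      finally have f1g2: "?E f\<^sub>1 g\<^sub>2 \<le> C * (r + r)" .
      have "1 * r \<le> C * r"
        using C r by (intro mult_right_mono) auto
      with e1 have g1f1: "?E g\<^sub>1 f\<^sub>1 \<le> C * r" by simp
      have "d \<le> C * (?E g\<^sub>1 f\<^sub>1 + ?E f\<^sub>1 g\<^sub>2)"
        unfolding d_def C_def by (rule energy_triangle[OF p0(2) opI gI(1) fI(1) gI(2)])
      also have "\<dots> \<le> C * (C * r + C * (r + r))"
        using C f1g2 g1f1 by (intro mult_left_mono add_mono) auto
      also have "\<dots> = 3 * (C\<^sup>2 * r)" by (simp add: power2_eq_square algebra_simps)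
      also have "C\<^sup>2 * r = d / 4" using C by (simp add: r_def)
      \<comment> \<open>No pair from these neighbourhoods is \<open>\<delta>\<close>-close on the
        overlap, so the required implication is vacuous.\<close>
      finally have False using d by simp
      then show "\<exists>f\<in>J_holomorphic J p (\<Omega>\<^sub>1 \<union> \<Omega>\<^sub>2).
          sobolev_norm p \<Omega>\<^sub>1 (\<lambda>z. f z - f\<^sub>1 z) < \<epsilon> \<and> sobolev_norm p \<Omega>\<^sub>2 (\<lambda>z. f z - f\<^sub>2 z) < \<epsilon>" ..
    qed
  qed
qed

lemma compactin_uniform_delta:
  fixes P :: "'a \<Rightarrow> real \<Rightarrow> bool"
  assumes K: "compactin X K"
    and loc: "\<And>x. x \<in> K \<Longrightarrow> \<exists>U \<delta>. openin X U \<and> x \<in> U \<and> 0 < \<delta> \<and> (\<forall>y\<in>U. P y \<delta>)"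
    and mono: "\<And>y \<delta> \<delta>'. P y \<delta> \<Longrightarrow> \<delta>' \<le> \<delta> \<Longrightarrow> P y \<delta>'"
  shows "\<exists>\<delta>>0. \<forall>y\<in>K. P y \<delta>"
proof -
  define \<U> where "\<U> = {U. openin X U \<and> (\<exists>\<delta>>0. \<forall>y\<in>U. P y \<delta>)}"
  have "Ball \<U> (openin X)" "K \<subseteq> \<Union>\<U>"
    using loc unfolding \<U>_def by blast+
  then obtain \<F> where \<F>: "finite \<F>" "\<F> \<subseteq> \<U>" "K \<subseteq> \<Union>\<F>"
    using K unfolding compactin_def by meson
  have "\<forall>U\<in>\<F>. \<exists>\<delta>. 0 < \<delta> \<and> (\<forall>y\<in>U. P y \<delta>)"
    using \<F>(2) unfolding \<U>_def by blast
  from bchoice[OF this] obtain \<delta> where \<delta>: "\<forall>U\<in>\<F>. 0 < \<delta> U \<and> (\<forall>y\<in>U. P y (\<delta> U))" ..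
  \<comment> \<open>The extra 1 keeps the minimum defined and positive when the subcover is
    empty.\<close>
  let ?m = "Min (insert 1 (\<delta> ` \<F>))"
  have "0 < ?m" using \<F>(1) \<delta> by simp
  moreover have "P y ?m" if "y \<in> K" for y
  proof -
    obtain U where U: "U \<in> \<F>" "y \<in> U" using \<F>(3) \<open>y \<in> K\<close> by blast
    show ?thesis
    proof (rule mono)
      show "P y (\<delta> U)" using U \<delta> by blast
      show "?m \<le> \<delta> U" using U(1) \<F>(1) by simp
    qed
  qed
  ultimately show ?thesis by blast
qed

theorem theorem1:
  fixes p :: real
    and \<Omega>\<^sub>1 \<Omega>\<^sub>2 :: "complex set"
    and J :: "real ^ ('n::finite + 'n) \<Rightarrow> real ^ ('n + 'n) ^ ('n + 'n)"
    and W\<^sub>1 W\<^sub>2 :: "(complex \<Rightarrow> real ^ ('n + 'n)) set"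
  assumes "p > 2"
    and "good_pair \<Omega>\<^sub>1 \<Omega>\<^sub>2"
    and "J \<in> almost_complex_structures"
    and "W\<^sub>1 \<subseteq> J_holomorphic J p \<Omega>\<^sub>1"
    and "W\<^sub>2 \<subseteq> J_holomorphic J p \<Omega>\<^sub>2"
    and "precompact_in (sobolev_topology p \<Omega>\<^sub>1) W\<^sub>1"
    and "precompact_in (sobolev_topology p \<Omega>\<^sub>2) W\<^sub>2"
  shows "\<forall>\<epsilon>>0. \<exists>\<delta>>0. \<forall>f\<^sub>1\<in>W\<^sub>1. \<forall>f\<^sub>2\<in>W\<^sub>2.
           sobolev_norm p (\<Omega>\<^sub>1 \<inter> \<Omega>\<^sub>2) (\<lambda>z. f\<^sub>1 z - f\<^sub>2 z) < \<delta> \<longrightarrow>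
           (\<exists>f\<in>J_holomorphic J p (\<Omega>\<^sub>1 \<union> \<Omega>\<^sub>2).
              sobolev_norm p \<Omega>\<^sub>1 (\<lambda>z. f z - f\<^sub>1 z) < \<epsilon> \<and>
              sobolev_norm p \<Omega>\<^sub>2 (\<lambda>z. f z - f\<^sub>2 z) < \<epsilon>)"
proof (intro allI impI)
  fix \<epsilon> :: real assume \<epsilon>: "\<epsilon> > 0"
  have p: "0 < p" "1 \<le> p" using assms(1) by simp_all
  have op: "open \<Omega>\<^sub>1" "open \<Omega>\<^sub>2" using assms(2) by (simp_all add: good_pair_def)
  have "smooth J" using assms(3) by (simp add: almost_complex_structures_def)
  then have "Ck 0 J" unfolding smooth_def by blast
  then have J: "continuous_on UNIV J" by simp
  let ?X1 = "sobolev_topology p \<Omega>\<^sub>1" and ?X2 = "sobolev_topology p \<Omega>\<^sub>2"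
  let ?C1 = "?X1 closure_of W\<^sub>1" and ?C2 = "?X2 closure_of W\<^sub>2"
  let ?P = "\<lambda>y \<delta>. sobolev_norm p (\<Omega>\<^sub>1 \<inter> \<Omega>\<^sub>2) (\<lambda>z. fst y z - snd y z) < \<delta> \<longrightarrow>
           (\<exists>f\<in>J_holomorphic J p (\<Omega>\<^sub>1 \<union> \<Omega>\<^sub>2).
              sobolev_norm p \<Omega>\<^sub>1 (\<lambda>z. f z - fst y z) < \<epsilon> \<and> sobolev_norm p \<Omega>\<^sub>2 (\<lambda>z. f z - snd y z) < \<epsilon>)"
  have hol: "?C1 \<subseteq> J_holomorphic J p \<Omega>\<^sub>1" "?C2 \<subseteq> J_holomorphic J p \<Omega>\<^sub>2"
    using J_holomorphic_closure[OF p(1) op(1) J assms(4)] J_holomorphic_closure[OF p(1) op(2) J assms(5)]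
    by blast+
  have W: "W\<^sub>1 \<subseteq> ?C1" "W\<^sub>2 \<subseteq> ?C2"
    using assms(6,7) by (auto simp: precompact_in_def intro!: closure_of_subset)
  have "compactin ?X1 ?C1" "compactin ?X2 ?C2"
    using assms(6,7) by (simp_all add: precompact_in_def)
  \<comment> \<open>A pair of maps becomes one point of the product space, so a single cover treats
    both families together.\<close>
  then have K: "compactin (prod_topology ?X1 ?X2) (?C1 \<times> ?C2)"
    by (simp add: compactin_Times)
  \<comment> \<open>The uniform constant is sought on the closures, where compactness is available;
    it then holds on the families inside them.\<close>
  have "\<exists>\<delta>>0. \<forall>y\<in>?C1 \<times> ?C2. ?P y \<delta>"
  proof (rule compactin_uniform_delta[OF K])
    fix x assume "x \<in> ?C1 \<times> ?C2"
    then obtain g\<^sub>1 g\<^sub>2 where x: "x = (g\<^sub>1, g\<^sub>2)" and g: "g\<^sub>1 \<in> J_holomorphic J p \<Omega>\<^sub>1" "g\<^sub>2 \<in> J_holomorphic J p \<Omega>\<^sub>2"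
      using hol by blast
    obtain U\<^sub>1 U\<^sub>2 \<delta> where U: "openin ?X1 U\<^sub>1" "openin ?X2 U\<^sub>2" "g\<^sub>1 \<in> U\<^sub>1" "g\<^sub>2 \<in> U\<^sub>2" "0 < \<delta>"
      "\<And>f\<^sub>1 f\<^sub>2. f\<^sub>1 \<in> U\<^sub>1 \<Longrightarrow> f\<^sub>2 \<in> U\<^sub>2 \<Longrightarrow> ?P (f\<^sub>1, f\<^sub>2) \<delta>"
      by (rule gluing_near_pair[OF p(2) op g \<epsilon>]) simp
    show "\<exists>U \<delta>. openin (prod_topology ?X1 ?X2) U \<and> x \<in> U \<and> 0 < \<delta> \<and> (\<forall>y\<in>U. ?P y \<delta>)"
    proof (intro exI conjI ballI)
      show "openin (prod_topology ?X1 ?X2) (U\<^sub>1 \<times> U\<^sub>2)" using U(1,2) by (simp add: openin_prod_Times_iff)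
      show "x \<in> U\<^sub>1 \<times> U\<^sub>2" using U(3,4) x by simp
      show "0 < \<delta>" by fact
      show "?P y \<delta>" if "y \<in> U\<^sub>1 \<times> U\<^sub>2" for y
        using U(6)[of "fst y" "snd y"] that by (simp add: mem_Times_iff)
    qed
  next
    show "?P y \<delta>'" if "?P y \<delta>" "\<delta>' \<le> \<delta>" for y \<delta> \<delta>'
      using that by (meson order_less_le_trans)
  qed
  then obtain \<delta> where \<delta>: "0 < \<delta>" "\<forall>y\<in>?C1 \<times> ?C2. ?P y \<delta>" by blast
  show "\<exists>\<delta>>0. \<forall>f\<^sub>1\<in>W\<^sub>1. \<forall>f\<^sub>2\<in>W\<^sub>2.
           sobolev_norm p (\<Omega>\<^sub>1 \<inter> \<Omega>\<^sub>2) (\<lambda>z. f\<^sub>1 z - f\<^sub>2 z) < \<delta> \<longrightarrow>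
           (\<exists>f\<in>J_holomorphic J p (\<Omega>\<^sub>1 \<union> \<Omega>\<^sub>2).
              sobolev_norm p \<Omega>\<^sub>1 (\<lambda>z. f z - f\<^sub>1 z) < \<epsilon> \<and>
              sobolev_norm p \<Omega>\<^sub>2 (\<lambda>z. f z - f\<^sub>2 z) < \<epsilon>)"
  proof (intro exI[of _ \<delta>] conjI ballI \<delta>(1))
    fix f\<^sub>1 f\<^sub>2 assume "f\<^sub>1 \<in> W\<^sub>1" "f\<^sub>2 \<in> W\<^sub>2"
    then have "(f\<^sub>1, f\<^sub>2) \<in> ?C1 \<times> ?C2" using W by blast
    from bspec[OF \<delta>(2) this]
    show "sobolev_norm p (\<Omega>\<^sub>1 \<inter> \<Omega>\<^sub>2) (\<lambda>z. f\<^sub>1 z - f\<^sub>2 z) < \<delta> \<longrightarrow>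
           (\<exists>f\<in>J_holomorphic J p (\<Omega>\<^sub>1 \<union> \<Omega>\<^sub>2).
              sobolev_norm p \<Omega>\<^sub>1 (\<lambda>z. f z - f\<^sub>1 z) < \<epsilon> \<and> sobolev_norm p \<Omega>\<^sub>2 (\<lambda>z. f z - f\<^sub>2 z) < \<epsilon>)"
      by simp
  qed
qed

end
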